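(* Let $c>0$ and $0\le\kappa<1/2$ be constants. Suppose conditions C1 and C2 (stated in the context) hold. Then for any $0<\beta<1/2-\kappa$ and $0\le\tau<1-2\kappa$ (where $\tau$ is the exponent in C1, $K_n=O(n^\tau)$), there exist positive constants $b_1,b_2,b_3$ depending on $c$, $c_1$ and $c_2$ such that $$P\Big(\max_{1\le l\le r}|\hat\rho_l-\rho_l|\ge c\,n^{-\kappa}\Big)\le O\Big\{r\Big[\exp\big(-b_1n^{1-2(\kappa+\beta)}+\tau\log n\big)+\exp\big(-b_2n^{\beta}+(1+\tau)\log n\big)+\exp\big(-b_3n^{1-2\kappa-\tau}+\tau\log n\big)\Big]\Big\}.$$ If, in addition, condition C3 (stated in the context) holds with these $c$ and $\kappa$, then $$P(\mathcal A\subseteq\hat{\mathcal A})\ge 1-O\Big(d_n\Big[\exp\big(-b_1n^{1-2(\kappa+\beta)}+\tau\log n\big)+\exp\big(-b_2n^{\beta}+(1+\tau)\log n\big)+\exp\big(-b_3n^{1-2\kappa-\tau}+\tau\log n\big)\Big]\Big),$$ where $d_n=|\mathcal A|$ is the cardinality of $\mathcal A$.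
   Context: Setting. $Y$ is a categorical random variable taking values $L_1,\dots,L_K$, $K\ge2$, with $p_k=P(Y=L_k)>0$. $\boldsymbol X=(X_1,\dots,X_p)^T$ is a random vector in $\mathbb R^p$ whose coordinates are partitioned into $r$ groups $\boldsymbol X_{(1)},\dots,\boldsymbol X_{(r)}$, where $\boldsymbol X_{(l)}=(X_{l1},\dots,X_{lq_l})^T\in\mathbb R^{q_l}$, $q_1+\cdots+q_r=p$, and the $q_l$ are finite. $n$ denotes the sample size; $p$, $r$ and the number of classes $K=K_n$ may depend on $n$. $\|\cdot\|$ is the Euclidean norm. Asymptotic notation is as $n\to\infty$. Gini distance correlation. Let $F_l$ be the distribution of $\boldsymbol X_{(l)}$ and $F_{l|k}$ the conditional distribution of $\boldsymbol X_{(l)}$ given $Y=L_k$; $\boldsymbol X_{(l|k)}$ denotes a random vector with distribution $F_{l|k}$. Let $\Delta_l=\mathbb E\|\boldsymbol X_{(l)1}-\boldsymbol X_{(l)2}\|$ with $\boldsymbol X_{(l)1},\boldsymbol X_{(l)2}$ i.i.d. from $F_l$, and $\Delta_{l|k}=\mathbb E\|\boldsymbol X_{(l|k)1}-\boldsymbol X_{(l|k)2}\|$ with $\boldsymbol X_{(l|k)1},\boldsymbol X_{(l|k)2}$ i.i.d. from $F_{l|k}$. The Gini distance correlation between $\boldsymbol X_{(l)}$ and $Y$ is $$\rho_l=\frac{\Delta_l-\sum_{k=1}^Kp_k\Delta_{l|k}}{\Delta_l}.$$ Estimator. Let $(\boldsymbol X_1,Y_1),\dots,(\boldsymbol X_n,Y_n)$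 be an i.i.d. sample from the joint distribution of $(\boldsymbol X,Y)$; $\boldsymbol X_{(l)i}$ is the $l$-th group of $\boldsymbol X_i$. Let $n_k=\sum_{i=1}^n\mathbf 1(Y_i=L_k)$, $\hat p_k=n_k/n$, and let $\boldsymbol X_{(l|k)1},\dots,\boldsymbol X_{(l|k)n_k}$ be the sample values $\boldsymbol X_{(l)i}$ with $Y_i=L_k$. Then $$\hat\rho_l=\frac{\binom n2^{-1}\sum_{1\le i<j\le n}\|\boldsymbol X_{(l)i}-\boldsymbol X_{(l)j}\|-\sum_{k=1}^K\hat p_k\binom{n_k}2^{-1}\sum_{1\le i<j\le n_k}\|\boldsymbol X_{(l|k)i}-\boldsymbol X_{(l|k)j}\|}{\binom n2^{-1}\sum_{1\le i<j\le n}\|\boldsymbol X_{(l)i}-\boldsymbol X_{(l)j}\|}.$$ Active set. Let $G(Y=L_k|\boldsymbol X)$ denote the conditional distribution of $Y$ given $\boldsymbol X$. The index set of active groups is $\mathcal A=\{l: G(Y=L_k|\boldsymbol X)\text{ functionally depends on }\boldsymbol X_{(l)}\text{ for some }k\}$. Its estimate is $\hat{\mathcal A}=\{l:\hat\rho_l\ge c\,n^{-\kappa},\ 1\le l\le r\}$. Conditions. C1: there exist positive constants $c_1,c_2$ such that $c_1/K_n\le\min_{1\le k\le K_n}p_k\le\max_{1\le k\le K_n}p_k\le c_2/K_n$, and $K_n=O(n^\tau)$ for some $\tau\ge0$. C2: there exists a positive constant $s_0$ such that for all $0\le s\le2s_0$, $\sup_r\max_{1\le l\le r}\sup_K\max_{1\le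 k\le K}\mathbb E\{\exp(s\|\boldsymbol X_{(l|k)}\|)\}<\infty$. C3: $\min_{l\in\mathcal A}\rho_l\ge2c\,n^{-\kappa}$, for some constants $c>0$ and $0\le\kappa<1/2$.
   Formalization: The formal theorem adds the assumption that the denominators Δ_l are bounded below by a positive constant, uniformly in l ≤ r and in n; without it the stated bound fails, since Δ_l may tend to 0 under C1 and C2. *)

theory Defs
  imports "HOL-Probability.Probability" "HOL-Library.Landau_Symbols"
begin

section \<open>Populations\<close>

text \<open>
  A population describes \<open>(X, Y)\<close> for one sample size. The coordinates of \<open>X\<close> are indexed by
  \<open>{1..dim}\<close>, the groups are index sets \<open>group l\<close> for \<open>l \<in> {1..ngroups}\<close>, and the categorical
  value \<open>L_k\<close> is identified with its label \<open>k \<in> {1..nclasses}\<close>. The dimension varies with the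
  sample size, so points of \<open>R^p\<close> are functions in the product space over \<open>{1..p}\<close>.
\<close>

record population =
  dim :: nat
  ngroups :: nat
  group :: "nat \<Rightarrow> nat set"
  nclasses :: nat
  law :: "((nat \<Rightarrow> real) \<times> nat) measure"

definition covariate_space :: "population \<Rightarrow> (nat \<Rightarrow> real) measure" where
  "covariate_space P = (\<Pi>\<^sub>M i\<in>{1..dim P}. borel)"

definition class_event :: "population \<Rightarrow> nat \<Rightarrow> ((nat \<Rightarrow> real) \<times> nat) set" where
  "class_event P k = {z \<in> space (law P). snd z = k}"

definition class_prob :: "population \<Rightarrow> nat \<Rightarrow> real" where
  "class_prob P k = measure (law P) (class_event P k)"

definition valid_population :: "population \<Rightarrow> bool" where
  "valid_population P \<longleftrightarrow>
     1 \<le> ngroups P \<and> 2 \<le> nclasses P \<and>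
     (\<Union>l\<in>{1..ngroups P}. group P l) = {1..dim P} \<and>
     disjoint_family_on (group P) {1..ngroups P} \<and>
     (\<forall>l\<in>{1..ngroups P}. group P l \<noteq> {}) \<and>
     prob_space (law P) \<and>
     sets (law P) = sets (covariate_space P \<Otimes>\<^sub>M count_space {1..nclasses P}) \<and>
     (\<forall>k\<in>{1..nclasses P}. class_prob P k > 0)"

section \<open>Gini distance correlation\<close>

text \<open>\<open>group_law P l\<close> is \<open>F_l\<close> and \<open>cond_group_law P l k\<close> is \<open>F_{l|k}\<close>.\<close>

definition group_law :: "population \<Rightarrow> nat \<Rightarrow> (nat \<Rightarrow> real) measure" where
  "group_law P l =
     distr (law P) (\<Pi>\<^sub>M i\<in>group P l. borel) (\<lambda>z. restrict (fst z) (group P l))"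

definition cond_group_law :: "population \<Rightarrow> nat \<Rightarrow> nat \<Rightarrow> (nat \<Rightarrow> real) measure" where
  "cond_group_law P l k =
     distr (uniform_measure (law P) (class_event P k)) (\<Pi>\<^sub>M i\<in>group P l. borel)
       (\<lambda>z. restrict (fst z) (group P l))"

definition group_dist :: "nat set \<Rightarrow> (nat \<Rightarrow> real) \<Rightarrow> (nat \<Rightarrow> real) \<Rightarrow> real" where
  "group_dist I x y = L2_set (\<lambda>i. x i - y i) I"

definition mean_difference :: "nat set \<Rightarrow> (nat \<Rightarrow> real) measure \<Rightarrow> real" where
  "mean_difference I F = (\<integral>z. group_dist I (fst z) (snd z) \<partial>(F \<Otimes>\<^sub>M F))"

definition gini_delta :: "population \<Rightarrow> nat \<Rightarrow> real" where
  "gini_delta P l = mean_difference (group P l) (group_law P l)"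

definition cond_gini_delta :: "population \<Rightarrow> nat \<Rightarrow> nat \<Rightarrow> real" where
  "cond_gini_delta P l k = mean_difference (group P l) (cond_group_law P l k)"

definition gini_cor :: "population \<Rightarrow> nat \<Rightarrow> real" where
  "gini_cor P l =
     (gini_delta P l - (\<Sum>k\<in>{1..nclasses P}. class_prob P k * cond_gini_delta P l k))
       / gini_delta P l"

section \<open>Estimator\<close>

definition iid_sample :: "'w measure \<Rightarrow> (nat \<Rightarrow> 'w \<Rightarrow> 'z) \<Rightarrow> nat \<Rightarrow> 'z measure \<Rightarrow> bool" where
  "iid_sample M Z n D \<longleftrightarrow>
     prob_space M \<and> prob_space.indep_vars M (\<lambda>_. D) Z {1..n} \<and>
     (\<forall>i\<in>{1..n}. distr M D (Z i) = D)"

text \<open>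
  A sample point is \<open>z :: nat \<Rightarrow> _\<close>, with observation \<open>z i = (X_i, Y_i)\<close> for \<open>i \<in> {1..n}\<close>.
  \<open>mean_pair_dist z l S\<close> averages over the pairs of observations with indices in \<open>S\<close>. If
  \<open>card S \<le> 1\<close> there are no pairs and the value is \<open>0\<close> (as \<open>0 / 0 = 0\<close>); this fixes
  the contribution to the estimator of a class observed at most once.
\<close>

definition mean_pair_dist ::
    "population \<Rightarrow> (nat \<Rightarrow> (nat \<Rightarrow> real) \<times> nat) \<Rightarrow> nat \<Rightarrow> nat set \<Rightarrow> real" where
  "mean_pair_dist P z l S =
     (\<Sum>(i, j)\<in>{(i, j). i \<in> S \<and> j \<in> S \<and> i < j}. group_dist (group P l) (fst (z i)) (fst (z j)))
       / real (card S choose 2)"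

definition class_indices :: "(nat \<Rightarrow> (nat \<Rightarrow> real) \<times> nat) \<Rightarrow> nat \<Rightarrow> nat \<Rightarrow> nat set" where
  "class_indices z n k = {i \<in> {1..n}. snd (z i) = k}"

definition gini_cor_hat ::
    "population \<Rightarrow> nat \<Rightarrow> (nat \<Rightarrow> (nat \<Rightarrow> real) \<times> nat) \<Rightarrow> nat \<Rightarrow> real" where
  "gini_cor_hat P n z l =
     (mean_pair_dist P z l {1..n} -
       (\<Sum>k\<in>{1..nclasses P}. real (card (class_indices z n k)) / real n *
          mean_pair_dist P z l (class_indices z n k)))
       / mean_pair_dist P z l {1..n}"

section \<open>Active groups\<close>

text \<open>
  \<open>G(Y = L_k | X = x)\<close> is determined only up to null sets. A group is active if for some class
  every version of this function depends on the group, so that altering a version on a null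
  set does not make a group active.
\<close>

definition cond_prob_version :: "population \<Rightarrow> nat \<Rightarrow> ((nat \<Rightarrow> real) \<Rightarrow> real) \<Rightarrow> bool" where
  "cond_prob_version P k g \<longleftrightarrow>
     g \<in> borel_measurable (covariate_space P) \<and>
     (AE z in law P. g (fst z) =
        real_cond_exp (law P) (vimage_algebra (space (law P)) fst (covariate_space P))
          (indicator (class_event P k)) z)"

definition depends_on_group :: "population \<Rightarrow> ((nat \<Rightarrow> real) \<Rightarrow> real) \<Rightarrow> nat \<Rightarrow> bool" where
  "depends_on_group P g l \<longleftrightarrow>
     (\<exists>x\<in>space (covariate_space P). \<exists>x'\<in>space (covariate_space P).
        (\<forall>i\<in>{1..dim P} - group P l. x i = x' i) \<and> g x \<noteq> g x')"

definition active_set :: "population \<Rightarrow> nat set" where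
  "active_set P =
     {l \<in> {1..ngroups P}. \<exists>k\<in>{1..nclasses P}. \<forall>g. cond_prob_version P k g \<longrightarrow> depends_on_group P g l}"

definition active_set_hat ::
    "population \<Rightarrow> real \<Rightarrow> real \<Rightarrow> nat \<Rightarrow> (nat \<Rightarrow> (nat \<Rightarrow> real) \<times> nat) \<Rightarrow> nat set" where
  "active_set_hat P c \<kappa> n z = {l \<in> {1..ngroups P}. gini_cor_hat P n z l \<ge> c * real n powr (- \<kappa>)}"

section \<open>Conditions\<close>

text \<open>\<open>P n\<close> is the population at sample size \<open>n\<close>; the suprema over \<open>r\<close> and \<open>K\<close> are suprema over \<open>n\<close>.\<close>

definition condC1 :: "real \<Rightarrow> real \<Rightarrow> real \<Rightarrow> (nat \<Rightarrow> population) \<Rightarrow> bool" where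
  "condC1 c1 c2 \<tau> P \<longleftrightarrow>
     (\<forall>n\<ge>1. c1 / real (nclasses (P n)) \<le> (MIN k\<in>{1..nclasses (P n)}. class_prob (P n) k) \<and>
             (MAX k\<in>{1..nclasses (P n)}. class_prob (P n) k) \<le> c2 / real (nclasses (P n))) \<and>
     (\<lambda>n. real (nclasses (P n))) \<in> O(\<lambda>n. real n powr \<tau>)"

definition condC2 :: "(nat \<Rightarrow> population) \<Rightarrow> bool" where
  "condC2 P \<longleftrightarrow>
     (\<exists>s0>0. \<forall>s\<in>{0..2 * s0}.
        (SUP n\<in>{1..}. SUP l\<in>{1..ngroups (P n)}. SUP k\<in>{1..nclasses (P n)}.
           \<integral>\<^sup>+ x. ennreal (exp (s * L2_set x (group (P n) l))) \<partial>(cond_group_law (P n) l k)) < \<infinity>)"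

definition condC3 :: "real \<Rightarrow> real \<Rightarrow> (nat \<Rightarrow> population) \<Rightarrow> bool" where
  "condC3 c \<kappa> P \<longleftrightarrow>
     (\<forall>n\<ge>1. \<forall>l\<in>active_set (P n). gini_cor (P n) l \<ge> 2 * c * real n powr (- \<kappa>))"

text \<open>
  The denominators of the Gini distance correlations stay away from \<open>0\<close>. This is not implied by
  the moment condition: for \<open>X = n^{-4} Y + J\<close> with \<open>Y\<close> uniform on \<open>{1, 2}\<close> and \<open>J\<close> an independent
  indicator with \<open>P(J = 1) = n^{-2}\<close>, the correlation tends to \<open>0\<close> while its estimate is \<open>1\<close> with
  probability tending to \<open>1\<close>.
\<close>

definition nondegenerate :: "(nat \<Rightarrow> population) \<Rightarrow> bool" where
  "nondegenerate P \<longleftrightarrow> (\<exists>\<delta>>0. \<forall>n\<ge>1. \<forall>l\<in>{1..ngroups (P n)}. gini_delta (P n) l \<ge> \<delta>)"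

definition error_rate :: "real \<Rightarrow> real \<Rightarrow> real \<Rightarrow> real \<Rightarrow> real \<Rightarrow> real \<Rightarrow> nat \<Rightarrow> real" where
  "error_rate b1 b2 b3 \<kappa> \<beta> \<tau> n =
     exp (- b1 * real n powr (1 - 2 * (\<kappa> + \<beta>)) + \<tau> * ln (real n)) +
     exp (- b2 * real n powr \<beta> + (1 + \<tau>) * ln (real n)) +
     exp (- b3 * real n powr (1 - 2 * \<kappa> - \<tau>) + \<tau> * ln (real n))"

end

theory Submission
  imports Defs
begin

text \<open>
  The pair averages \<open>binom(n, 2)\<^sup>-\<^sup>1 \<Sum>\<^sub>i\<^sub><\<^sub>j \<parallel>X\<^sub>i - X\<^sub>j\<parallel>\<close> change by at most \<open>(2 / n) (\<parallel>x\<parallel> + \<parallel>x'\<parallel>)\<close> when one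
  observation is replaced. For such functions the bounded difference method works with exponential
  moments in place of boundedness, without truncation, and gives deviations of order \<open>n\<^sup>-\<^sup>\<kappa>\<close>
  probability at most \<open>exp (- C n powr (1 - 2 \<kappa>))\<close>. The within-class averages have the same property
  conditionally on the labels, where the class sample sizes are fixed. Their conditional mean differs
  from the average of \<open>\<Delta>\<^sub>l\<^sub>|\<^sub>k\<close> over the observed labels only through classes observed once, hence by
  \<open>O(K / n) = o(n\<^sup>-\<^sup>\<kappa>)\<close>, and that average is a mean of bounded i.i.d. variables.
  The constant \<open>C\<close> depends on the population sequence, but \<open>n powr (2 \<beta>)\<close> absorbs it into the
  first term of the rate, so that \<open>b\<^sub>1 = b\<^sub>2 = b\<^sub>3 = 1\<close> works.
\<close>

section \<open>Bounded differences under exponential moments\<close>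

text \<open>Whole observations \<open>(X_i, Y_i)\<close> cannot be fed into the bounded difference
  method for the within-class term. Moving an observation to another class changes the normalisation
  of two class averages, and the resulting change contains average distances among the remaining
  members, which are unbounded and not controlled by the replaced and the replacing point. With
  frozen labels only one class average moves, and its weight \<open>n_k / n\<close> cancels its own
  normalisation, so the change is of order \<open>1 / n\<close> however small the class is. The
  price is a centre that depends on the labels; its fluctuation is a third source of error, next to
  those of the two pair averages. All three errors are brought under the same exponent. For pair
  averages the weight is the norm, with exponential moment at most \<open>B\<close>; for the label
  mean the weight is the constant \<open>B / s\<close>, whose exponential moment is
  \<open>exp B\<close>. This is why \<open>exp B\<close> replaces \<open>B\<close> in the final
  estimate.\<close>

definition exp_moment_le :: "'a measure \<Rightarrow> ('a \<Rightarrow> real) \<Rightarrow> real \<Rightarrow> real \<Rightarrow> bool" where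
  "exp_moment_le F w s B \<longleftrightarrow> prob_space F \<and> w \<in> borel_measurable F \<and> (\<forall>x\<in>space F. 0 \<le> w x) \<and>
     0 < s \<and> 0 \<le> B \<and> (\<integral>\<^sup>+x. ennreal (exp (s * w x)) \<partial>F) \<le> ennreal B"

lemma exp_moment_leD:
  assumes "exp_moment_le F w s B"
  shows "prob_space F" "w \<in> borel_measurable F" "\<And>x. x \<in> space F \<Longrightarrow> 0 \<le> w x"
    "0 < s" "0 \<le> B" "(\<integral>\<^sup>+x. ennreal (exp (s * w x)) \<partial>F) \<le> ennreal B"
  using assms by (auto simp: exp_moment_le_def)

lemma exp_moment_le_integrable_exp:
  assumes "exp_moment_le F w s B"
  shows "integrable F (\<lambda>x. exp (s * w x))" "(\<integral>x. exp (s * w x) \<partial>F) \<le> B"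
proof -
  note [measurable] = exp_moment_leD(2)[OF assms]
  note D = exp_moment_leD[OF assms]
  show i: "integrable F (\<lambda>x. exp (s * w x))"
    using D(6) by (intro integrableI_bounded) (auto simp: less_top[symmetric] top_unique)
  show "(\<integral>x. exp (s * w x) \<partial>F) \<le> B"
    using D(5,6) nn_integral_eq_integral[OF i] by simp
qed

lemma exp_moment_le_integrable:
  assumes "exp_moment_le F w s B"
  shows "integrable F w" "(\<integral>x. w x \<partial>F) \<le> B / s" "0 \<le> (\<integral>x. w x \<partial>F)"
proof -
  note [measurable] = exp_moment_leD(2)[OF assms]
  note D = exp_moment_leD[OF assms]
  note E = exp_moment_le_integrable_exp[OF assms]
  have le: "w x \<le> exp (s * w x) / s" for x
  proof -
    have "s * w x \<le> exp (s * w x)"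
      using exp_ge_add_one_self[of "s * w x"] by linarith
    then show ?thesis
      using D(4) by (simp add: field_simps)
  qed
  show i: "integrable F w"
  proof (rule Bochner_Integration.integrable_bound[of _ "\<lambda>x. exp (s * w x) / s"])
    show "AE x in F. norm (w x) \<le> norm (exp (s * w x) / s)"
    proof (rule AE_I2)
      fix x assume "x \<in> space F"
      then show "norm (w x) \<le> norm (exp (s * w x) / s)"
        using D(3)[of x] D(4) le[of x] by simp
    qed
  qed (use E in auto)
  have "(\<integral>x. w x \<partial>F) \<le> (\<integral>x. exp (s * w x) / s \<partial>F)"
    by (rule integral_mono) (use i E le in auto)
  also have "\<dots> \<le> B / s"
    using E(2) D(4) by (simp add: divide_right_mono)
  finally show "(\<integral>x. w x \<partial>F) \<le> B / s" .
  show "0 \<le> (\<integral>x. w x \<partial>F)"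
    by (rule Bochner_Integration.integral_nonneg_AE) (use D(3) in auto)
qed

text \<open>Second order Taylor formula with Lagrange remainder. The factor
  \<open>exp \<bar>u\<bar>\<close> is kept because \<open>u\<close> will be unbounded.\<close>

lemma exp_le_quadratic:
  fixes u :: real
  shows "exp u \<le> 1 + u + u\<^sup>2 / 2 * exp \<bar>u\<bar>"
proof -
  obtain t where t: "\<bar>t\<bar> \<le> \<bar>u\<bar>" "exp u = (\<Sum>m<2. u ^ m / fact m) + exp t / fact 2 * u ^ 2"
    using Maclaurin_exp_le[of u 2] by auto
  have "exp t * u\<^sup>2 \<le> exp \<bar>u\<bar> * u\<^sup>2"
    using t(1) by (intro mult_right_mono) auto
  then show ?thesis
    using t(2) by (simp add: numeral_2_eq_2 field_simps)
qed

text \<open>The available exponential \<open>exp (s * v)\<close> is split in two halves: one pays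
  for the square, by \<open>v^2 <= 8 / s^2 * exp (s * v / 2)\<close>, the other for
  \<open>exp \<bar>u\<bar>\<close>, which is where \<open>\<epsilon> \<le> s / 2\<close> enters.
  This takes the place of Hoeffding's lemma for variables without a bound.\<close>

lemma exp_le_linear_plus_exp:
  fixes u v s \<epsilon> :: real
  assumes "\<bar>u\<bar> \<le> \<epsilon> * v" "0 \<le> v" "0 \<le> \<epsilon>" "\<epsilon> \<le> s / 2" "0 < s"
  shows "exp u \<le> 1 + u + \<epsilon>\<^sup>2 * (4 / s\<^sup>2) * exp (s * v)"
proof -
  have "u\<^sup>2 \<le> (\<epsilon> * v)\<^sup>2"
    using assms(1) by (metis abs_ge_zero power2_abs power_mono)
  moreover have "v\<^sup>2 \<le> 8 / s\<^sup>2 * exp (s * v / 2)"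
  proof -
    have "(s * v / 2)\<^sup>2 / 2 \<le> exp (s * v / 2)"
      using exp_lower_Taylor_quadratic[of "s * v / 2"] assms by (smt (verit) mult_nonneg_nonneg divide_nonneg_pos)
    then show ?thesis
      using assms(5) by (simp add: field_simps power2_eq_square)
  qed
  ultimately have sq: "u\<^sup>2 \<le> \<epsilon>\<^sup>2 * (8 / s\<^sup>2 * exp (s * v / 2))"
    by (smt (verit) mult_left_mono power_mult_distrib zero_le_power2)
  have "\<epsilon> * v \<le> s / 2 * v"
    using assms by (intro mult_right_mono)
  then have e: "exp \<bar>u\<bar> \<le> exp (s * v / 2)"
    using assms(1) by simp
  have "u\<^sup>2 / 2 * exp \<bar>u\<bar> \<le> \<epsilon>\<^sup>2 * (8 / s\<^sup>2 * exp (s * v / 2)) / 2 * exp (s * v / 2)"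
    using divide_right_mono[OF sq, of 2] e by (intro mult_mono) simp_all
  also have "\<dots> = \<epsilon>\<^sup>2 * (4 / s\<^sup>2) * exp (s * v)"
    by (simp add: mult.assoc flip: exp_add)
  finally show ?thesis
    using exp_le_quadratic[of u] by linarith
qed

text \<open>The deviation from the mean is the average of \<open>h x - h y\<close> over an
  independent copy \<open>y\<close>; the mean of \<open>w\<close> is at most \<open>B / s\<close>
  because \<open>s * w \<le> exp (s * w)\<close>.\<close>

lemma bounded_oscillation:
  assumes w: "exp_moment_le F w s B"
    and h: "h \<in> borel_measurable F"
    and osc: "\<And>x y. x \<in> space F \<Longrightarrow> y \<in> space F \<Longrightarrow> \<bar>h x - h y\<bar> \<le> a * (w x + w y)"
    and "0 \<le> a"
  shows "integrable F h"
    and "\<And>x. x \<in> space F \<Longrightarrow> \<bar>h x - (\<integral>y. h y \<partial>F)\<bar> \<le> a * (w x + B / s)"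
proof -
  interpret prob_space F
    using w by (rule exp_moment_leD)
  note D = exp_moment_leD[OF w] and W = exp_moment_le_integrable[OF w]
  obtain x0 where x0: "x0 \<in> space F"
    using not_empty by auto
  show i: "integrable F h"
  proof (rule Bochner_Integration.integrable_bound[of _ "\<lambda>x. \<bar>h x0\<bar> + a * (w x + w x0)"])
    show "AE x in F. norm (h x) \<le> norm (\<bar>h x0\<bar> + a * (w x + w x0))"
      using osc[OF _ x0] by (intro AE_I2) (simp, smt (verit))
  qed (use W h in auto)
  fix x assume x: "x \<in> space F"
  have "\<bar>h x - (\<integral>y. h y \<partial>F)\<bar> = \<bar>\<integral>y. h x - h y \<partial>F\<bar>"
    using i by (simp add: prob_space)
  also have "\<dots> \<le> (\<integral>y. \<bar>h x - h y\<bar> \<partial>F)"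
    by (rule integral_abs_bound)
  also have "\<dots> \<le> (\<integral>y. a * (w x + w y) \<partial>F)"
    using W i osc[OF x] by (intro integral_mono) auto
  also have "\<dots> = a * (w x + (\<integral>y. w y \<partial>F))"
    using W by (simp add: prob_space)
  also have "\<dots> \<le> a * (w x + B / s)"
    using W \<open>0 \<le> a\<close> by (intro mult_left_mono) auto
  finally show "\<bar>h x - (\<integral>y. h y \<partial>F)\<bar> \<le> a * (w x + B / s)" .
qed

text \<open>After centring, the linear term of the expansion integrates to zero. The quadratic
  remainder is applied with \<open>v = w x + B / s\<close>; the shift \<open>B / s\<close> costs the
  factor \<open>exp (s * (B / s)) = exp B\<close>, hence the constant
  \<open>4 * B * exp B / s\<^sup>2\<close>.\<close>

lemma mgf_bounded_oscillation:
  assumes w: "exp_moment_le F w s B"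
    and h: "h \<in> borel_measurable F"
    and osc: "\<And>x y. x \<in> space F \<Longrightarrow> y \<in> space F \<Longrightarrow> \<bar>h x - h y\<bar> \<le> a * (w x + w y)"
    and a: "0 \<le> a" "\<bar>\<theta>\<bar> * a \<le> s / 2"
  shows "(\<integral>\<^sup>+x. ennreal (exp (\<theta> * (h x - (\<integral>y. h y \<partial>F)))) \<partial>F)
           \<le> ennreal (exp (4 * B * exp B / s\<^sup>2 * \<theta>\<^sup>2 * a\<^sup>2))"
proof -
  interpret prob_space F
    using w by (rule exp_moment_leD)
  note D = exp_moment_leD[OF w] and W = exp_moment_le_integrable[OF w]
    and E = exp_moment_le_integrable_exp[OF w]
  note H = bounded_oscillation[OF w h osc a(1), simplified]
  define m where "m = (\<integral>y. h y \<partial>F)"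
  define q where "q = (\<bar>\<theta>\<bar> * a)\<^sup>2 * (4 / s\<^sup>2)"
  define g where "g x = 1 + \<theta> * (h x - m) + q * (exp (s * w x) * exp B)" for x
  have le: "exp (\<theta> * (h x - m)) \<le> g x" if x: "x \<in> space F" for x
  proof -
    have "\<bar>\<theta> * (h x - m)\<bar> \<le> \<bar>\<theta>\<bar> * a * (w x + B / s)"
      using H(2)[OF x] by (simp add: abs_mult m_def mult.assoc mult_left_mono)
    then have "exp (\<theta> * (h x - m)) \<le> 1 + \<theta> * (h x - m) + q * exp (s * (w x + B / s))"
      unfolding q_def using D(3)[OF x] D(4,5) a by (intro exp_le_linear_plus_exp) auto
    then show ?thesis
      using D(4) by (simp add: g_def ring_distribs exp_add)
  qed
  have ig: "integrable F g"
    unfolding g_def using H E by auto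
  have "(\<integral>\<^sup>+x. ennreal (exp (\<theta> * (h x - m))) \<partial>F) \<le> (\<integral>\<^sup>+x. ennreal (g x) \<partial>F)"
    using le by (intro nn_integral_mono) (auto simp: ennreal_leI)
  also have "\<dots> = ennreal (\<integral>x. g x \<partial>F)"
    using ig le by (intro nn_integral_eq_integral) (auto intro!: AE_I2 order_trans[OF _ le])
  also have "(\<integral>x. g x \<partial>F) = 1 + q * ((\<integral>x. exp (s * w x) \<partial>F) * exp B)"
    unfolding g_def using H E by (simp add: prob_space m_def)
  also have "ennreal \<dots> \<le> ennreal (1 + q * (B * exp B))"
    using E by (intro ennreal_leI add_left_mono mult_left_mono mult_right_mono) (auto simp: q_def)
  also have "\<dots> \<le> ennreal (exp (q * (B * exp B)))"
    by (intro ennreal_leI exp_ge_add_one_self)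
  also have "q * (B * exp B) = 4 * B * exp B / s\<^sup>2 * \<theta>\<^sup>2 * a\<^sup>2"
    by (simp add: q_def power_mult_distrib)
  finally show ?thesis
    unfolding m_def .
qed

text \<open>McDiarmid's martingale argument as an induction on the coordinates. Averaging
  \<open>f\<close> over one coordinate gives a function \<open>g\<close> with the same difference
  bounds in the others, and \<open>exp (\<theta> * (f - m))\<close> factors into a part that does
  not involve that coordinate and a centred part covered by the one-variable estimate. Integrability
  is carried along because identifying the means of \<open>f\<close> and \<open>g\<close> uses
  Fubini's theorem.\<close>

lemma mgf_bounded_differences:
  fixes f :: "('i \<Rightarrow> 'a) \<Rightarrow> real"
  assumes "finite I"
    and w: "\<And>i. exp_moment_le (F i) w s B"
    and f: "f \<in> borel_measurable (PiM I F)"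
    and diff: "\<And>x i b. x \<in> space (PiM I F) \<Longrightarrow> i \<in> I \<Longrightarrow> b \<in> space (F i) \<Longrightarrow>
                 \<bar>f (x(i := b)) - f x\<bar> \<le> a i * (w b + w (x i))"
    and a: "\<And>i. i \<in> I \<Longrightarrow> 0 \<le> a i" "\<And>i. i \<in> I \<Longrightarrow> \<bar>\<theta>\<bar> * a i \<le> s / 2"
  shows "integrable (PiM I F) f \<and>
    (\<integral>\<^sup>+x. ennreal (exp (\<theta> * (f x - (\<integral>y. f y \<partial>PiM I F)))) \<partial>PiM I F)
       \<le> ennreal (exp (4 * B * exp B / s\<^sup>2 * \<theta>\<^sup>2 * (\<Sum>i\<in>I. (a i)\<^sup>2)))"
  using assms(1) f diff a
proof (induction I arbitrary: f rule: finite_induct)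
  case empty
  interpret product_sigma_finite F
    by (simp add: product_sigma_finite_def exp_moment_leD(1)[OF w] prob_space_imp_sigma_finite)
  show ?case
    by (simp add: PiM_empty integrable_count_space lebesgue_integral_count_space_finite
        nn_integral_count_space_finite)
next
  case (insert i J)
  have pF: "prob_space (F i)" for i
    using w by (rule exp_moment_leD)
  interpret product_sigma_finite F
    by (simp add: product_sigma_finite_def pF prob_space_imp_sigma_finite)
  interpret Fi: prob_space "F i"
    by (rule pF)
  interpret J: prob_space "PiM J F"
    by (intro prob_space_PiM pF)
  note [measurable] = insert.prems(1) and D = exp_moment_leD[OF w]
  note \<open>finite J\<close>[simp] and \<open>i \<notin> J\<close>[simp]
  define g where "g x = (\<integral>y. f (x(i := y)) \<partial>F i)" for x
  have upd: "(\<lambda>(x, y). x(i := y)) \<in> measurable (PiM J F \<Otimes>\<^sub>M F i) (PiM (insert i J) F)"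
    using measurable_add_dim[of i J F] by simp
  have [measurable]: "(\<lambda>(x, y). f (x(i := y))) \<in> borel_measurable (PiM J F \<Otimes>\<^sub>M F i)"
    using measurable_comp[OF upd insert.prems(1)] by (simp add: comp_def case_prod_beta)
  have g[measurable]: "g \<in> borel_measurable (PiM J F)"
    unfolding g_def by measurable
  have sp: "x(i := y) \<in> space (PiM (insert i J) F)" if "x \<in> space (PiM J F)" "y \<in> space (F i)" for x y
    using that by (auto simp: space_PiM PiE_iff extensional_def)
  have sec: "(\<lambda>y. f (x(i := y))) \<in> borel_measurable (F i)" if "x \<in> space (PiM J F)" for x
    using measurable_Pair2[OF _ that, of "\<lambda>(x, y). f (x(i := y))"] by simp
  have osc: "\<bar>f (x(i := y)) - f (x(i := z))\<bar> \<le> a i * (w y + w z)"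
    if "x \<in> space (PiM J F)" "y \<in> space (F i)" "z \<in> space (F i)" for x y z
    using insert.prems(2)[OF sp[OF that(1,3)], of i y] that by (simp add: fun_upd_def[symmetric] del: fun_upd_apply) (simp only: fun_upd_upd fun_upd_same)
  have ai: "0 \<le> a i" "\<bar>\<theta>\<bar> * a i \<le> s / 2"
    using insert.prems(3,4)[of i] by auto
  have fi: "integrable (F i) (\<lambda>y. f (x(i := y)))" if "x \<in> space (PiM J F)" for x
    by (rule bounded_oscillation(1)[OF w sec[OF that] osc[OF that] ai(1)])
  have fg: "\<bar>f (x(i := y)) - g x\<bar> \<le> a i * (w y + B / s)"
    if "x \<in> space (PiM J F)" "y \<in> space (F i)" for x y
    unfolding g_def by (rule bounded_oscillation(2)[OF w sec[OF that(1)] osc[OF that(1)] ai(1) that(2)])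
  have gdiff: "\<bar>g (x(j := b)) - g x\<bar> \<le> a j * (w b + w (x j))"
    if x: "x \<in> space (PiM J F)" and j: "j \<in> J" and b: "b \<in> space (F j)" for x j b
  proof -
    have x': "x(j := b) \<in> space (PiM J F)"
      using x j b by (auto simp: space_PiM PiE_iff extensional_def)
    have ij: "i \<noteq> j"
      using j \<open>i \<notin> J\<close> by blast
    have "\<bar>g (x(j := b)) - g x\<bar> = \<bar>\<integral>y. f (x(j := b, i := y)) - f (x(i := y)) \<partial>F i\<bar>"
      using fi[OF x] fi[OF x'] by (simp add: g_def)
    also have "\<dots> \<le> (\<integral>y. \<bar>f (x(j := b, i := y)) - f (x(i := y))\<bar> \<partial>F i)"
      by (rule integral_abs_bound)
    also have "\<dots> \<le> (\<integral>y. a j * (w b + w (x j)) \<partial>F i)"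
    proof (rule integral_mono)
      fix y assume y: "y \<in> space (F i)"
      show "\<bar>f (x(j := b, i := y)) - f (x(i := y))\<bar> \<le> a j * (w b + w (x j))"
        using insert.prems(2)[OF sp[OF x y], of j b] j b ij by (simp add: fun_upd_twist[OF ij] del: fun_upd_apply) (simp add: fun_upd_other)
    qed (use fi[OF x] fi[OF x'] in auto)
    also have "\<dots> = a j * (w b + w (x j))"
      by (simp add: Fi.prob_space)
    finally show ?thesis .
  qed
  have IH: "integrable (PiM J F) g"
    "(\<integral>\<^sup>+x. ennreal (exp (\<theta> * (g x - (\<integral>y. g y \<partial>PiM J F)))) \<partial>PiM J F)
       \<le> ennreal (exp (4 * B * exp B / s\<^sup>2 * \<theta>\<^sup>2 * (\<Sum>i\<in>J. (a i)\<^sup>2)))"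
    using insert.IH[OF g gdiff] insert.prems(3,4) by auto
  \<comment> \<open>Dominated by \<open>\<bar>g x\<bar> + a i * (w y + B / s)\<close>, where
    \<open>g\<close> is integrable by the induction hypothesis.\<close>
  have int: "integrable (PiM (insert i J) F) f"
  proof (rule integrableI_bounded)
    have "(\<integral>\<^sup>+x. ennreal (norm (f x)) \<partial>PiM (insert i J) F)
        = (\<integral>\<^sup>+x. \<integral>\<^sup>+y. ennreal \<bar>f (x(i := y))\<bar> \<partial>F i \<partial>PiM J F)"
      by (subst product_nn_integral_insert) auto
    also have "\<dots> \<le> (\<integral>\<^sup>+x. \<integral>\<^sup>+y. ennreal (\<bar>g x\<bar> + a i * (w y + B / s)) \<partial>F i \<partial>PiM J F)"
    proof (intro nn_integral_mono ennreal_leI)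
      fix x y assume "x \<in> space (PiM J F)" "y \<in> space (F i)"
      from fg[OF this]
      show "\<bar>f (x(i := y))\<bar> \<le> \<bar>g x\<bar> + a i * (w y + B / s)"
        by linarith
    qed
    also have "\<dots> = (\<integral>\<^sup>+x. ennreal (\<bar>g x\<bar> + a i * ((\<integral>y. w y \<partial>F i) + B / s)) \<partial>PiM J F)"
    proof (intro nn_integral_cong)
      fix x
      show "(\<integral>\<^sup>+y. ennreal (\<bar>g x\<bar> + a i * (w y + B / s)) \<partial>F i)
          = ennreal (\<bar>g x\<bar> + a i * ((\<integral>y. w y \<partial>F i) + B / s))"
        using exp_moment_le_integrable[OF w, of i] D(3)[of _ i] D(4,5) ai
        by (subst nn_integral_eq_integral) (auto simp: Fi.prob_space)
    qed
    also have "\<dots> = ennreal (\<integral>x. \<bar>g x\<bar> + a i * ((\<integral>y. w y \<partial>F i) + B / s) \<partial>PiM J F)"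
      using exp_moment_le_integrable[OF w, of i] IH(1) D(4,5) ai
      by (intro nn_integral_eq_integral) auto
    also have "\<dots> < \<infinity>"
      by simp
    finally show "(\<integral>\<^sup>+x. ennreal (norm (f x)) \<partial>PiM (insert i J) F) < \<infinity>" .
  qed simp
  have Ef: "(\<integral>y. f y \<partial>PiM (insert i J) F) = (\<integral>y. g y \<partial>PiM J F)" (is "_ = ?m")
    by (subst product_integral_insert) (auto simp: int g_def[abs_def])
  let ?C = "4 * B * exp B / s\<^sup>2 * \<theta>\<^sup>2"
  have "(\<integral>\<^sup>+x. ennreal (exp (\<theta> * (f x - ?m))) \<partial>PiM (insert i J) F)
      = (\<integral>\<^sup>+x. \<integral>\<^sup>+y. ennreal (exp (\<theta> * (f (x(i := y)) - ?m))) \<partial>F i \<partial>PiM J F)"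
    by (subst product_nn_integral_insert) auto
  also have "\<dots> = (\<integral>\<^sup>+x. ennreal (exp (\<theta> * (g x - ?m))) *
      (\<integral>\<^sup>+y. ennreal (exp (\<theta> * (f (x(i := y)) - g x))) \<partial>F i) \<partial>PiM J F)"
  proof (intro nn_integral_cong)
    fix x assume x: "x \<in> space (PiM J F)"
    note [measurable] = sec[OF x]
    have "(\<integral>\<^sup>+y. ennreal (exp (\<theta> * (f (x(i := y)) - ?m))) \<partial>F i)
       = (\<integral>\<^sup>+y. ennreal (exp (\<theta> * (g x - ?m))) * ennreal (exp (\<theta> * (f (x(i := y)) - g x))) \<partial>F i)"
      by (intro nn_integral_cong) (simp add: ennreal_mult[symmetric] exp_add[symmetric] ring_distribs)
    then show "(\<integral>\<^sup>+y. ennreal (exp (\<theta> * (f (x(i := y)) - ?m))) \<partial>F i) = ennreal (exp (\<theta> * (g x - ?m))) *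
      (\<integral>\<^sup>+y. ennreal (exp (\<theta> * (f (x(i := y)) - g x))) \<partial>F i)"
      by (simp add: nn_integral_cmult)
  qed
  also have "\<dots> \<le> (\<integral>\<^sup>+x. ennreal (exp (\<theta> * (g x - ?m))) * ennreal (exp (?C * (a i)\<^sup>2)) \<partial>PiM J F)"
  proof (intro nn_integral_mono mult_left_mono)
    fix x assume x: "x \<in> space (PiM J F)"
    show "(\<integral>\<^sup>+y. ennreal (exp (\<theta> * (f (x(i := y)) - g x))) \<partial>F i) \<le> ennreal (exp (?C * (a i)\<^sup>2))"
      unfolding g_def by (rule mgf_bounded_oscillation[OF w sec[OF x] osc[OF x] ai])
  qed simp
  also have "\<dots> = (\<integral>\<^sup>+x. ennreal (exp (\<theta> * (g x - ?m))) \<partial>PiM J F) * ennreal (exp (?C * (a i)\<^sup>2))"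
    by (rule nn_integral_multc) simp
  also have "\<dots> \<le> ennreal (exp (?C * (\<Sum>i\<in>J. (a i)\<^sup>2))) * ennreal (exp (?C * (a i)\<^sup>2))"
    using IH(2) by (rule mult_right_mono) simp
  also have "\<dots> = ennreal (exp (?C * (\<Sum>i\<in>insert i J. (a i)\<^sup>2)))"
    by (simp add: ennreal_mult[symmetric] exp_add[symmetric] ring_distribs add.commute)
  finally show ?case
    using int Ef by simp
qed

text \<open>Chernoff's bound for both tails. The parameter \<open>\<theta>\<close> stays free: it is
  optimised only when the scale of \<open>t\<close> is known, subject to the limit that the
  exponential moment imposes.\<close>

lemma prob_bounded_differences:
  fixes f :: "('i \<Rightarrow> 'a) \<Rightarrow> real"
  assumes "finite I"
    and w: "\<And>i. exp_moment_le (F i) w s B"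
    and f[measurable]: "f \<in> borel_measurable (PiM I F)"
    and diff: "\<And>x i b. x \<in> space (PiM I F) \<Longrightarrow> i \<in> I \<Longrightarrow> b \<in> space (F i) \<Longrightarrow>
                 \<bar>f (x(i := b)) - f x\<bar> \<le> a i * (w b + w (x i))"
    and a: "\<And>i. i \<in> I \<Longrightarrow> 0 \<le> a i" "\<And>i. i \<in> I \<Longrightarrow> \<theta> * a i \<le> s / 2" "0 < \<theta>"
  shows "measure (PiM I F) {x \<in> space (PiM I F). t \<le> \<bar>f x - (\<integral>y. f y \<partial>PiM I F)\<bar>}
    \<le> 2 * exp (4 * B * exp B / s\<^sup>2 * \<theta>\<^sup>2 * (\<Sum>i\<in>I. (a i)\<^sup>2) - \<theta> * t)"
proof -
  interpret prob_space "PiM I F"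
    by (intro prob_space_PiM exp_moment_leD(1)[OF w])
  define m where "m = (\<integral>y. f y \<partial>PiM I F)"
  define V where "V = 4 * B * exp B / s\<^sup>2 * \<theta>\<^sup>2 * (\<Sum>i\<in>I. (a i)\<^sup>2)"
  \<comment> \<open>The sign \<open>\<sigma>\<close> is 1 or -1, so that both tails share one
    proof.\<close>
  have tail: "prob {x \<in> space (PiM I F). t \<le> \<sigma> * (f x - m)} \<le> exp (V - \<theta> * t)"
    if \<sigma>: "\<bar>\<sigma>\<bar> = 1" for \<sigma>
  proof -
    have "\<sigma> * \<sigma> = 1"
      using \<sigma> by (simp add: abs_if split: if_splits)
    then have \<sigma>2: "(\<theta> * \<sigma>)\<^sup>2 = \<theta>\<^sup>2"
      by (simp add: power2_eq_square algebra_simps)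
    have "ennreal (prob {x \<in> space (PiM I F). t \<le> \<sigma> * (f x - m)})
        = emeasure (PiM I F) {x \<in> space (PiM I F). t \<le> \<sigma> * (f x - m)}"
      by (rule emeasure_eq_measure[symmetric])
    also have "\<dots> = (\<integral>\<^sup>+x. indicator {x \<in> space (PiM I F). t \<le> \<sigma> * (f x - m)} x \<partial>PiM I F)"
      by (rule nn_integral_indicator[symmetric]) measurable
    also have "\<dots> \<le> (\<integral>\<^sup>+x. ennreal (exp (- \<theta> * t)) * ennreal (exp (\<theta> * \<sigma> * (f x - m))) \<partial>PiM I F)"
    proof (rule nn_integral_mono)
      fix x
      show "(indicator {x \<in> space (PiM I F). t \<le> \<sigma> * (f x - m)} x :: ennreal)
          \<le> ennreal (exp (- \<theta> * t)) * ennreal (exp (\<theta> * \<sigma> * (f x - m)))"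
      proof (cases "t \<le> \<sigma> * (f x - m)")
        case True
        then have "\<theta> * t \<le> \<theta> * (\<sigma> * (f x - m))"
          using a(3) by (intro mult_left_mono) auto
        then have "1 \<le> exp (- \<theta> * t) * exp (\<theta> * \<sigma> * (f x - m))"
          by (simp add: exp_add[symmetric] mult.assoc)
        then have "1 \<le> ennreal (exp (- \<theta> * t)) * ennreal (exp (\<theta> * \<sigma> * (f x - m)))"
          using ennreal_leI[of 1] by (simp add: ennreal_mult[symmetric])
        then show ?thesis
          by (auto simp: indicator_def)
      qed auto
    qed
    also have "\<dots> = ennreal (exp (- \<theta> * t)) * (\<integral>\<^sup>+x. ennreal (exp (\<theta> * \<sigma> * (f x - m))) \<partial>PiM I F)"
      by (rule nn_integral_cmult) measurable
    also have "\<dots> \<le> ennreal (exp (- \<theta> * t)) * ennreal (exp V)"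
    proof (rule mult_left_mono)
      show "(\<integral>\<^sup>+x. ennreal (exp (\<theta> * \<sigma> * (f x - m))) \<partial>PiM I F) \<le> ennreal (exp V)"
        using mgf_bounded_differences[OF assms(1-4), where \<theta> = "\<theta> * \<sigma>"] a \<sigma>
        by (simp add: m_def V_def \<sigma>2 abs_mult)
    qed simp
    also have "\<dots> = ennreal (exp (V - \<theta> * t))"
      by (simp add: ennreal_mult[symmetric] exp_add[symmetric])
    finally show ?thesis
      by simp
  qed
  have "prob {x \<in> space (PiM I F). t \<le> \<bar>f x - m\<bar>}
      \<le> prob ({x \<in> space (PiM I F). t \<le> 1 * (f x - m)} \<union> {x \<in> space (PiM I F). t \<le> (- 1) * (f x - m)})"
    by (intro finite_measure_mono) auto
  also have "\<dots> \<le> exp (V - \<theta> * t) + exp (V - \<theta> * t)"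
    by (intro order_trans[OF measure_Un_le] add_mono tail) auto
  finally show ?thesis
    by (simp add: m_def V_def)
qed

section \<open>Pair averages\<close>

definition index_pairs :: "nat set \<Rightarrow> (nat \<times> nat) set" where
  "index_pairs S = {(i, j). i \<in> S \<and> j \<in> S \<and> i < j}"

text \<open>The U-statistic of order two with an arbitrary kernel. As in
  \<open>mean_pair_dist\<close>, division by zero gives the value 0 on index sets with fewer than
  two elements.\<close>

definition pair_mean :: "('a \<Rightarrow> 'a \<Rightarrow> real) \<Rightarrow> (nat \<Rightarrow> 'a) \<Rightarrow> nat set \<Rightarrow> real" where
  "pair_mean d x S = (\<Sum>(i, j)\<in>index_pairs S. d (x i) (x j)) / real (card S choose 2)"

lemma finite_index_pairs: "finite S \<Longrightarrow> finite (index_pairs S)"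
  by (rule finite_subset[of _ "S \<times> S"]) (auto simp: index_pairs_def)

lemma real_choose_two: "real (n choose 2) = real n * (real n - 1) / 2"
  by (induction n) (auto simp: numeral_2_eq_2 field_simps)

lemma card_index_pairs:
  assumes "finite S"
  shows "card (index_pairs S) = card S choose 2"
  using assms
proof (induction S rule: finite_linorder_max_induct)
  case empty
  show ?case by (simp add: index_pairs_def)
next
  case (insert b S)
  have eq: "index_pairs (insert b S) = index_pairs S \<union> (\<lambda>i. (i, b)) ` S"
    using insert.hyps(2) by (auto simp: index_pairs_def)
  have "card (index_pairs (insert b S)) = card (index_pairs S) + card ((\<lambda>i. (i, b)) ` S)"
    unfolding eq using insert.hyps by (intro card_Un_disjoint finite_index_pairs finite_imageI)
      (auto simp: index_pairs_def)
  also have "card ((\<lambda>i. (i, b)) ` S) = card S"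
    by (intro card_image inj_onI) auto
  finally show ?case
    using insert.IH insert.hyps by (subst card_insert_disjoint) (auto simp: numeral_2_eq_2)
qed

lemma card_index_pairs_containing:
  assumes "finite S" "i \<in> S"
  shows "card {p \<in> index_pairs S. fst p = i \<or> snd p = i} \<le> card S - 1"
proof -
  have "{p \<in> index_pairs S. fst p = i \<or> snd p = i}
      \<subseteq> (\<lambda>j. if i < j then (i, j) else (j, i)) ` (S - {i})"
    by (force simp: index_pairs_def image_iff)
  then have "card {p \<in> index_pairs S. fst p = i \<or> snd p = i} \<le> card (S - {i})"
    using assms(1) by (meson card_image_le card_mono finite_Diff finite_imageI order_trans)
  then show ?thesis
    using assms by simp
qed

lemma pair_mean_small: "finite S \<Longrightarrow> card S < 2 \<Longrightarrow> pair_mean d x S = 0"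
  by (simp add: pair_mean_def)

lemma pair_mean_cong: "(\<And>i. i \<in> S \<Longrightarrow> x i = y i) \<Longrightarrow> pair_mean d x S = pair_mean d y S"
  unfolding pair_mean_def by (intro arg_cong2[where f = "(/)"] sum.cong) (auto simp: index_pairs_def)

text \<open>At most \<open>card S - 1\<close> pairs contain \<open>i\<close>, each changes by at
  most \<open>w b + w (x i)\<close>, and the normalisation is
  \<open>card S * (card S - 1) / 2\<close>. The factor \<open>card S\<close> stands on the left
  because class averages enter the estimator with weight proportional to the class size; in this
  form the bound does not depend on the size and survives \<open>card S < 2\<close>.\<close>

lemma pair_mean_bounded_differences:
  fixes d :: "'a \<Rightarrow> 'a \<Rightarrow> real"
  assumes d: "\<And>a b c. \<bar>d a c - d b c\<bar> \<le> w a + w b" "\<And>a b c. \<bar>d c a - d c b\<bar> \<le> w a + w b"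
    and S: "finite S" "i \<in> S"
  shows "real (card S) * \<bar>pair_mean d (x(i := b)) S - pair_mean d x S\<bar> \<le> 2 * (w b + w (x i))"
proof (cases "card S < 2")
  case True
  have "0 \<le> w b + w (x i)"
    using d(1)[of b b "x i"] by (smt (verit))
  then show ?thesis
    using True S by (simp add: pair_mean_small)
next
  case False
  let ?e = "w b + w (x i)" and ?m = "real (card S)" and ?y = "x(i := b)"
  have e: "0 \<le> ?e"
    using d(1)[of b b "x i"] by (smt (verit))
  have "\<bar>(\<Sum>p\<in>index_pairs S. d (?y (fst p)) (?y (snd p))) - (\<Sum>p\<in>index_pairs S. d (x (fst p)) (x (snd p)))\<bar>
      \<le> (\<Sum>p\<in>index_pairs S. \<bar>d (?y (fst p)) (?y (snd p)) - d (x (fst p)) (x (snd p))\<bar>)"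
    by (simp add: sum_subtractf[symmetric])
  also have "\<dots> \<le> (\<Sum>p\<in>index_pairs S. if fst p = i \<or> snd p = i then ?e else 0)"
    using d by (intro sum_mono) (auto simp: index_pairs_def)
  also have "\<dots> = real (card {p \<in> index_pairs S. fst p = i \<or> snd p = i}) * ?e"
    using finite_index_pairs[OF S(1)] by (simp add: sum.If_cases Int_def)
  also have "\<dots> \<le> (?m - 1) * ?e"
    using card_index_pairs_containing[OF S] False e by (intro mult_right_mono) auto
  finally have le: "\<bar>(\<Sum>p\<in>index_pairs S. d (?y (fst p)) (?y (snd p))) -
      (\<Sum>p\<in>index_pairs S. d (x (fst p)) (x (snd p)))\<bar> \<le> (?m - 1) * ?e" (is "\<bar>?A\<bar> \<le> _") .
  have "pair_mean d ?y S - pair_mean d x S = ?A / (?m * (?m - 1) / 2)"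
    by (simp add: pair_mean_def real_choose_two case_prod_beta' diff_divide_distrib)
  also have "?m * \<bar>\<dots>\<bar> = 2 / (?m - 1) * \<bar>?A\<bar>"
  proof -
    have "m * \<bar>A / (m * (m - 1) / 2)\<bar> = 2 / (m - 1) * \<bar>A\<bar>" if "1 < m" for m A :: real
      using that by (simp add: abs_divide abs_mult)
    from this[of ?m ?A] False show ?thesis
      by linarith
  qed
  also have "\<dots> \<le> 2 / (?m - 1) * ((?m - 1) * ?e)"
    using le False by (intro mult_left_mono) auto
  also have "\<dots> = 2 * ?e"
    using False by simp
  finally show ?thesis .
qed

text \<open>Both sides agree on rectangles: the preimage of a rectangle is a box whose remaining
  factors are full spaces of mass 1.\<close>

lemma distr_PiM_pair:
  assumes "finite I" "\<And>i. prob_space (F i)" "i \<in> I" "j \<in> I" "i \<noteq> j"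
  shows "distr (PiM I F) (F i \<Otimes>\<^sub>M F j) (\<lambda>x. (x i, x j)) = F i \<Otimes>\<^sub>M F j"
proof (rule pair_measure_eqI[symmetric])
  interpret product_sigma_finite F
    by (simp add: product_sigma_finite_def assms(2) prob_space_imp_sigma_finite)
  show "sigma_finite_measure (F i)" "sigma_finite_measure (F j)"
    by (simp_all add: assms(2) prob_space_imp_sigma_finite)
  show "sets (F i \<Otimes>\<^sub>M F j) = sets (distr (PiM I F) (F i \<Otimes>\<^sub>M F j) (\<lambda>x. (x i, x j)))"
    by simp
  fix A C assume A[measurable]: "A \<in> sets (F i)" and C[measurable]: "C \<in> sets (F j)"
  let ?E = "\<lambda>k. if k = i then A else if k = j then C else space (F k)"
  have [measurable]: "(\<lambda>x. x i) \<in> measurable (PiM I F) (F i)" "(\<lambda>x. x j) \<in> measurable (PiM I F) (F j)"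
    using assms by auto
  have sub: "A \<subseteq> space (F i)" "C \<subseteq> space (F j)"
    using sets.sets_into_space[OF A] sets.sets_into_space[OF C] by auto
  have "emeasure (distr (PiM I F) (F i \<Otimes>\<^sub>M F j) (\<lambda>x. (x i, x j))) (A \<times> C)
      = emeasure (PiM I F) ((\<lambda>x. (x i, x j)) -` (A \<times> C) \<inter> space (PiM I F))"
    by (intro emeasure_distr) auto
  also have "(\<lambda>x. (x i, x j)) -` (A \<times> C) \<inter> space (PiM I F) = Pi\<^sub>E I ?E"
    using assms sub by (auto simp: space_PiM PiE_iff split: if_splits) (metis subsetD)
  also have "emeasure (PiM I F) (Pi\<^sub>E I ?E) = (\<Prod>k\<in>I. emeasure (F k) (?E k))"
    using assms by (intro emeasure_PiM) auto
  also have "\<dots> = (\<Prod>k\<in>I. (if k = i then emeasure (F i) A else 1) * (if k = j then emeasure (F j) C else 1))"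
    using assms by (intro prod.cong) (auto simp: prob_space.emeasure_space_1)
  also have "\<dots> = emeasure (F i) A * emeasure (F j) C"
    using assms by (simp add: prod.distrib prod.delta)
  finally show "emeasure (F i) A * emeasure (F j) C
    = emeasure (distr (PiM I F) (F i \<Otimes>\<^sub>M F j) (\<lambda>x. (x i, x j))) (A \<times> C)" ..
qed

lemma exp_moment_le_distance:
  assumes F: "exp_moment_le F w s B"
    and d: "(\<lambda>z. d (fst z) (snd z)) \<in> borel_measurable (F \<Otimes>\<^sub>M F)"
      "\<And>a b. 0 \<le> d a b" "\<And>a b. d a b \<le> w a + w b"
  shows "integrable (F \<Otimes>\<^sub>M F) (\<lambda>z. d (fst z) (snd z))"
    "0 \<le> (\<integral>z. d (fst z) (snd z) \<partial>(F \<Otimes>\<^sub>M F))"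
    "(\<integral>z. d (fst z) (snd z) \<partial>(F \<Otimes>\<^sub>M F)) \<le> 2 * B / s"
proof -
  interpret F: prob_space F
    using F by (rule exp_moment_leD)
  interpret FF: pair_prob_space F F ..
  note W = exp_moment_le_integrable[OF F]
  note [measurable] = exp_moment_leD(2)[OF F]
  have i1: "integrable (F \<Otimes>\<^sub>M F) (\<lambda>z. w (fst z))" "(\<integral>z. w (fst z) \<partial>(F \<Otimes>\<^sub>M F)) = (\<integral>x. w x \<partial>F)"
    using W(1) integrable_distr_eq[of fst "F \<Otimes>\<^sub>M F" F w] integral_distr[of fst "F \<Otimes>\<^sub>M F" F w]
    by (simp_all add: F.distr_pair_fst)
  have i2: "integrable (F \<Otimes>\<^sub>M F) (\<lambda>z. w (snd z))" "(\<integral>z. w (snd z) \<partial>(F \<Otimes>\<^sub>M F)) = (\<integral>x. w x \<partial>F)"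
    using FF.integrable_product_swap[OF i1(1)] FF.integral_product_swap[of "\<lambda>z. w (fst z)"] i1
    by (simp_all add: case_prod_beta')
  note i = i1(1) i2(1)
  show int: "integrable (F \<Otimes>\<^sub>M F) (\<lambda>z. d (fst z) (snd z))"
    using d by (intro Bochner_Integration.integrable_bound[OF Bochner_Integration.integrable_add[OF i]])
      (auto intro!: AE_I2 order_trans[OF d(3)])
  show "0 \<le> (\<integral>z. d (fst z) (snd z) \<partial>(F \<Otimes>\<^sub>M F))"
    using d(2) by (intro Bochner_Integration.integral_nonneg) auto
  have "(\<integral>z. d (fst z) (snd z) \<partial>(F \<Otimes>\<^sub>M F)) \<le> (\<integral>z. w (fst z) + w (snd z) \<partial>(F \<Otimes>\<^sub>M F))"
    using int i d(3) by (intro integral_mono) auto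
  also have "\<dots> = 2 * (\<integral>x. w x \<partial>F)"
    using i i1(2) i2(2) by simp
  also have "\<dots> \<le> 2 * B / s"
    using W(2) by simp
  finally show "(\<integral>z. d (fst z) (snd z) \<partial>(F \<Otimes>\<^sub>M F)) \<le> 2 * B / s" .
qed

section \<open>Conditioning on labels\<close>

text \<open>Conditioning a product measure on a box conditions each factor separately, so given the
  labels \<open>v\<close> the projected observations are independent with laws
  \<open>F_{l|k}\<close>, where \<open>k = v i\<close>. The two laws are compared on boxes;
  multiplying by the mass of the conditioning box removes the division.\<close>

lemma measure_PiM_labelled:
  fixes D :: "'z measure" and \<phi> :: "'z \<Rightarrow> 'a" and v :: "'i \<Rightarrow> 'k"
  assumes I: "finite I" and D: "prob_space D" and \<phi>[measurable]: "\<phi> \<in> measurable D T"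
    and C: "\<And>i. C (v i) \<in> sets D" "\<And>i. 0 < measure D (C (v i))"
    and A[measurable]: "A \<in> sets (PiM I (\<lambda>_. T))"
  shows "measure (PiM I (\<lambda>_. D))
      {z \<in> space (PiM I (\<lambda>_. D)). (\<forall>i\<in>I. z i \<in> C (v i)) \<and> (\<lambda>i\<in>I. \<phi> (z i)) \<in> A}
    = (\<Prod>i\<in>I. measure D (C (v i))) *
        measure (PiM I (\<lambda>i. distr (uniform_measure D (C (v i))) T \<phi>)) A"
proof -
  interpret D: prob_space D by (rule D)
  interpret Q: prob_space "PiM I (\<lambda>_. D)"
    by (intro prob_space_PiM D)
  interpret DP: product_sigma_finite "\<lambda>_. D"
    by (simp add: product_sigma_finite_def D prob_space_imp_sigma_finite)
  let ?Q = "PiM I (\<lambda>_. D)"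
  define L where "L = (\<Pi>\<^sub>E i\<in>I. C (v i))"
  define \<Phi> where "\<Phi> z = (\<lambda>i\<in>I. \<phi> (z i))" for z
  define F where "F i = distr (uniform_measure D (C (v i))) T \<phi>" for i
  define c where "c = (\<Prod>i\<in>I. measure D (C (v i)))"
  have [measurable]: "C (v i) \<in> sets D" for i
    by (rule C)
  have \<Phi>[measurable]: "\<Phi> \<in> measurable ?Q (PiM I (\<lambda>_. T))"
    unfolding \<Phi>_def by measurable
  have L[measurable]: "L \<in> sets ?Q"
    unfolding L_def using I C by (intro sets_PiM_I_finite) auto
  have c: "0 < c"
    unfolding c_def using C by (intro prod_pos) auto
  have em: "emeasure ?Q (Pi\<^sub>E I E) = ennreal (\<Prod>i\<in>I. measure D (E i))" if "\<And>i. i \<in> I \<Longrightarrow> E i \<in> sets D" for E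
    using I that by (simp add: DP.emeasure_PiM D.emeasure_eq_measure prod_ennreal)
  have eL: "emeasure ?Q L = ennreal c" "measure ?Q L = c"
    using em[of "\<lambda>i. C (v i)"] C c by (auto simp: L_def c_def measure_def)
  have pF: "prob_space (F i)" for i
    unfolding F_def using C(2)[of i]
    by (intro prob_space.prob_space_distr prob_space_uniform_measure) (auto simp: D.emeasure_eq_measure)
  interpret FP: product_sigma_finite F
    by (simp add: product_sigma_finite_def pF prob_space_imp_sigma_finite)
  have eF: "emeasure (F i) E = ennreal (measure D (C (v i) \<inter> (\<phi> -` E \<inter> space D)) / measure D (C (v i)))"
    if [measurable]: "E \<in> sets T" for i E
    unfolding F_def using C(2)[of i]
    by (subst emeasure_distr) (auto simp: D.emeasure_eq_measure divide_ennreal)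
  have "distr (uniform_measure ?Q L) (PiM I (\<lambda>_. T)) \<Phi> = PiM I F"
  proof (rule FP.PiM_eqI[OF I])
    show "sets (distr (uniform_measure ?Q L) (PiM I (\<lambda>_. T)) \<Phi>) = sets (PiM I F)"
      by (auto simp: F_def intro!: sets_PiM_cong)
    fix E assume "\<And>i. i \<in> I \<Longrightarrow> E i \<in> sets (F i)"
    then have E: "E i \<in> sets T" if "i \<in> I" for i
      using that by (simp add: F_def)
    have "emeasure (distr (uniform_measure ?Q L) (PiM I (\<lambda>_. T)) \<Phi>) (Pi\<^sub>E I E)
        = emeasure (uniform_measure ?Q L) (\<Phi> -` Pi\<^sub>E I E \<inter> space ?Q)"
      using E I by (subst emeasure_distr) (auto intro!: sets_PiM_I_finite)
    also have "\<dots> = emeasure ?Q (L \<inter> (\<Phi> -` Pi\<^sub>E I E \<inter> space ?Q)) / emeasure ?Q L"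
      using E I by (intro emeasure_uniform_measure L measurable_sets[OF \<Phi>] sets_PiM_I_finite) auto
    also have "L \<inter> (\<Phi> -` Pi\<^sub>E I E \<inter> space ?Q) = (\<Pi>\<^sub>E i\<in>I. C (v i) \<inter> (\<phi> -` E i \<inter> space D))"
      by (auto simp: L_def \<Phi>_def space_PiM PiE_iff)
    also have "emeasure ?Q \<dots> = ennreal (\<Prod>i\<in>I. measure D (C (v i) \<inter> (\<phi> -` E i \<inter> space D)))"
      using C E by (intro em) (auto intro: measurable_sets[OF \<phi>])
    also have "\<dots> / emeasure ?Q L = ennreal (\<Prod>i\<in>I. measure D (C (v i) \<inter> (\<phi> -` E i \<inter> space D)) / measure D (C (v i)))"
      using c by (simp add: eL divide_ennreal prod_nonneg c_def prod_dividef)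
    also have "\<dots> = (\<Prod>i\<in>I. emeasure (F i) (E i))"
      using E by (simp add: eF prod_ennreal)
    finally show "emeasure (distr (uniform_measure ?Q L) (PiM I (\<lambda>_. T)) \<Phi>) (Pi\<^sub>E I E)
      = (\<Prod>i\<in>I. emeasure (F i) (E i))" .
  qed
  then have "measure (PiM I F) A = measure (uniform_measure ?Q L) (\<Phi> -` A \<inter> space ?Q)"
    using measure_distr[of \<Phi> "uniform_measure ?Q L" "PiM I (\<lambda>_. T)" A] by simp
  also have "\<dots> = measure ?Q (L \<inter> (\<Phi> -` A \<inter> space ?Q)) / c"
    using eL c by (subst measure_uniform_measure) auto
  also have "L \<inter> (\<Phi> -` A \<inter> space ?Q)
      = {z \<in> space ?Q. (\<forall>i\<in>I. z i \<in> C (v i)) \<and> (\<lambda>i\<in>I. \<phi> (z i)) \<in> A}"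
    by (auto simp: L_def \<Phi>_def space_PiM PiE_iff extensional_def)
  finally show ?thesis
    using c by (simp add: F_def[abs_def] c_def[symmetric])
qed

text \<open>An event whose description depends on the random labels is cut into finitely many pieces
  on which the labels are frozen. The default \<open>k0\<close> makes a label vector a total
  function with values in \<open>K\<close>, so that the family of class laws indexed by it consists
  of probability measures at every index, also outside \<open>I\<close>.\<close>

lemma PiM_label_decomposition:
  fixes D :: "'z measure" and \<phi> :: "'z \<Rightarrow> 'a" and lab :: "'z \<Rightarrow> 'k" and k0 :: 'k and I :: "'i set"
  defines "ext \<equiv> \<lambda>g i. if i \<in> I then g i else k0"
  defines "E \<equiv> \<lambda>A g. {z \<in> space (PiM I (\<lambda>_. D)).
      (\<forall>i\<in>I. z i \<in> {z \<in> space D. lab z = ext g i}) \<and> (\<lambda>i\<in>I. \<phi> (z i)) \<in> A (ext g)}"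
  assumes I: "finite I" and \<phi>[measurable]: "\<phi> \<in> measurable D T"
    and K: "k0 \<in> K" "\<And>z. z \<in> space D \<Longrightarrow> lab z \<in> K"
    and C: "\<And>k. k \<in> K \<Longrightarrow> {z \<in> space D. lab z = k} \<in> sets D"
    and A: "\<And>v. (\<And>i. v i \<in> K) \<Longrightarrow> A v \<in> sets (PiM I (\<lambda>_. T))"
  shows "{z \<in> space (PiM I (\<lambda>_. D)). (\<lambda>i\<in>I. \<phi> (z i)) \<in> A (\<lambda>i. if i \<in> I then lab (z i) else k0)}
      = (\<Union>g\<in>I \<rightarrow>\<^sub>E K. E A g)"
    and "g \<in> I \<rightarrow>\<^sub>E K \<Longrightarrow> E A g \<in> sets (PiM I (\<lambda>_. D))"
proof -
  let ?Q = "PiM I (\<lambda>_. D)" and ?C = "\<lambda>k. {z \<in> space D. lab z = k}" and ?V = "I \<rightarrow>\<^sub>E K"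
  have \<Phi>: "(\<lambda>z. \<lambda>i\<in>I. \<phi> (z i)) \<in> measurable ?Q (PiM I (\<lambda>_. T))"
    by measurable
  show "E A g \<in> sets ?Q" if g: "g \<in> ?V" for g
  proof -
    have ext: "ext g i \<in> K" for i
      using g K by (auto simp: ext_def)
    have "E A g = (\<Pi>\<^sub>E i\<in>I. ?C (ext g i)) \<inter> ((\<lambda>z. \<lambda>i\<in>I. \<phi> (z i)) -` A (ext g) \<inter> space ?Q)"
      by (auto simp: E_def space_PiM PiE_iff extensional_def)
    also have "\<dots> \<in> sets ?Q"
      using I C ext
      by (intro sets.Int sets_PiM_I_finite measurable_sets[OF \<Phi>] A) auto
    finally show ?thesis .
  qed
  show "{z \<in> space ?Q. (\<lambda>i\<in>I. \<phi> (z i)) \<in> A (\<lambda>i. if i \<in> I then lab (z i) else k0)} = (\<Union>g\<in>?V. E A g)"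
    (is "?S = _")
  proof (intro equalityI subsetI)
    fix z assume z: "z \<in> ?S"
    have "(\<lambda>i. if i \<in> I then lab (z i) else k0) = ext (\<lambda>i\<in>I. lab (z i))"
      by (auto simp: ext_def)
    with z K(2) show "z \<in> (\<Union>g\<in>?V. E A g)"
      by (intro UN_I[of "\<lambda>i\<in>I. lab (z i)"]) (auto simp: E_def space_PiM PiE_iff ext_def)
  next
    fix z assume "z \<in> (\<Union>g\<in>?V. E A g)"
    then obtain g where g: "g \<in> ?V" "z \<in> E A g"
      by auto
    then have "(\<lambda>i. if i \<in> I then lab (z i) else k0) = ext g"
      by (auto simp: ext_def E_def)
    with g show "z \<in> ?S"
      by (simp add: E_def)
  qed
qed

text \<open>Gives measurability of statistics with random index sets: each of the finitely many
  frozen pieces is measurable.\<close>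

lemma sets_PiM_labelled:
  fixes D :: "'z measure" and \<phi> :: "'z \<Rightarrow> 'a" and lab :: "'z \<Rightarrow> 'k"
  assumes I: "finite I" and \<phi>: "\<phi> \<in> measurable D T"
    and K: "finite K" "k0 \<in> K" "\<And>z. z \<in> space D \<Longrightarrow> lab z \<in> K"
    and C: "\<And>k. k \<in> K \<Longrightarrow> {z \<in> space D. lab z = k} \<in> sets D"
    and A: "\<And>v. (\<And>i. v i \<in> K) \<Longrightarrow> A v \<in> sets (PiM I (\<lambda>_. T))"
  shows "{z \<in> space (PiM I (\<lambda>_. D)). (\<lambda>i\<in>I. \<phi> (z i)) \<in> A (\<lambda>i. if i \<in> I then lab (z i) else k0)}
    \<in> sets (PiM I (\<lambda>_. D))"
proof -
  let ?E = "\<lambda>g. {z \<in> space (PiM I (\<lambda>_. D)).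
      (\<forall>i\<in>I. z i \<in> {z \<in> space D. lab z = (if i \<in> I then g i else k0)}) \<and>
      (\<lambda>i\<in>I. \<phi> (z i)) \<in> A (\<lambda>i. if i \<in> I then g i else k0)}"
  have "(\<Union>g\<in>I \<rightarrow>\<^sub>E K. ?E g) \<in> sets (PiM I (\<lambda>_. D))"
  proof (rule sets.finite_UN)
    show "finite (I \<rightarrow>\<^sub>E K)"
      using I K by (intro finite_PiE) auto
    show "?E g \<in> sets (PiM I (\<lambda>_. D))" if "g \<in> I \<rightarrow>\<^sub>E K" for g
      by (rule PiM_label_decomposition(2)[OF I \<phi> K(2)]) (use K C A that in auto)
  qed
  then show ?thesis
    by (subst PiM_label_decomposition(1)[where K = K and T = T, OF I \<phi> K(2)]) (use K C A in auto)
qed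

text \<open>Law of total probability: a bound on the conditional probability that is uniform over
  label vectors carries over, since the masses of all label vectors sum to the product over
  \<open>I\<close> of the total class mass, which is 1.\<close>

lemma measure_PiM_conditional_bound:
  fixes D :: "'z measure" and \<phi> :: "'z \<Rightarrow> 'a" and lab :: "'z \<Rightarrow> 'k"
  assumes I: "finite I" and D: "prob_space D" and \<phi>: "\<phi> \<in> measurable D T"
    and K: "finite K" "k0 \<in> K" "\<And>z. z \<in> space D \<Longrightarrow> lab z \<in> K"
    and C: "\<And>k. k \<in> K \<Longrightarrow> {z \<in> space D. lab z = k} \<in> sets D"
      "\<And>k. k \<in> K \<Longrightarrow> 0 < measure D {z \<in> space D. lab z = k}"
    and A: "\<And>v. (\<And>i. v i \<in> K) \<Longrightarrow> A v \<in> sets (PiM I (\<lambda>_. T))"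
      "\<And>v. (\<And>i. v i \<in> K) \<Longrightarrow>
         measure (PiM I (\<lambda>i. distr (uniform_measure D {z \<in> space D. lab z = v i}) T \<phi>)) (A v) \<le> b"
  shows "measure (PiM I (\<lambda>_. D))
      {z \<in> space (PiM I (\<lambda>_. D)). (\<lambda>i\<in>I. \<phi> (z i)) \<in> A (\<lambda>i. if i \<in> I then lab (z i) else k0)} \<le> b"
proof -
  interpret D: prob_space D by (rule D)
  let ?Q = "PiM I (\<lambda>_. D)"
  interpret Q: prob_space ?Q
    by (intro prob_space_PiM D)
  define ext where "ext g = (\<lambda>i. if i \<in> I then g i else k0)" for g :: "'b \<Rightarrow> 'k"
  let ?C = "\<lambda>k. {z \<in> space D. lab z = k}"
  let ?V = "I \<rightarrow>\<^sub>E K"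
  let ?E = "\<lambda>g. {z \<in> space ?Q. (\<forall>i\<in>I. z i \<in> ?C (ext g i)) \<and> (\<lambda>i\<in>I. \<phi> (z i)) \<in> A (ext g)}"
  have ext: "ext g i \<in> K" if "g \<in> ?V" for g i
    using that K by (auto simp: ext_def)
  have fin: "finite ?V"
    using I K by (intro finite_PiE) auto
  have "{z \<in> space ?Q. (\<lambda>i\<in>I. \<phi> (z i)) \<in> A (\<lambda>i. if i \<in> I then lab (z i) else k0)} = (\<Union>g\<in>?V. ?E g)"
    (is "?S = _")
    unfolding ext_def by (rule PiM_label_decomposition(1)[OF I \<phi> K(2)]) (use K C A in auto)
  moreover have "measure ?Q (\<Union>g\<in>?V. ?E g) \<le> (\<Sum>g\<in>?V. measure ?Q (?E g))"
    by (rule Q.finite_measure_subadditive_finite[OF fin]) (rule image_subsetI, unfold ext_def,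
        rule PiM_label_decomposition(2)[OF I \<phi> K(2)], use K C A in auto)
  ultimately have "measure ?Q ?S \<le> (\<Sum>g\<in>?V. measure ?Q (?E g))"
    by simp
  also have "\<dots> \<le> (\<Sum>g\<in>?V. (\<Prod>i\<in>I. measure D (?C (g i))) * b)"
  proof (rule sum_mono)
    fix g assume g: "g \<in> ?V"
    have "measure ?Q (?E g) = (\<Prod>i\<in>I. measure D (?C (ext g i))) *
        measure (PiM I (\<lambda>i. distr (uniform_measure D (?C (ext g i))) T \<phi>)) (A (ext g))"
      using ext[OF g] by (intro measure_PiM_labelled I D \<phi> C A(1)) auto
    also have "\<dots> \<le> (\<Prod>i\<in>I. measure D (?C (ext g i))) * b"
      using ext[OF g] by (intro mult_left_mono A(2) prod_nonneg) auto
    also have "(\<Prod>i\<in>I. measure D (?C (ext g i))) = (\<Prod>i\<in>I. measure D (?C (g i)))"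
      by (intro prod.cong) (auto simp: ext_def)
    finally show "measure ?Q (?E g) \<le> (\<Prod>i\<in>I. measure D (?C (g i))) * b" .
  qed
  also have "\<dots> = (\<Prod>i\<in>I. \<Sum>k\<in>K. measure D (?C k)) * b"
    using I K by (subst prod_sum_PiE) (simp_all add: sum_distrib_right)
  also have "(\<Sum>k\<in>K. measure D (?C k)) = 1"
  proof -
    have "(\<Sum>k\<in>K. measure D (?C k)) = measure D (\<Union>k\<in>K. ?C k)"
      using K C by (intro D.finite_measure_finite_Union[symmetric]) (auto simp: disjoint_family_on_def)
    also have "(\<Union>k\<in>K. ?C k) = space D"
      using K(3) by auto
    finally show ?thesis
      by (simp add: D.prob_space)
  qed
  finally show ?thesis
    by (simp only: prod.neutral_const mult_1_left)
qed

section \<open>Concentration of classwise pair averages\<close>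

text \<open>Holds for a distance with \<open>w\<close> the norm. The inequalities are required at
  all points, so that no membership in the space has to be tracked when a sample is updated.\<close>

locale pair_kernel =
  fixes T :: "'a measure" and w :: "'a \<Rightarrow> real" and d :: "'a \<Rightarrow> 'a \<Rightarrow> real"
  assumes d_measurable[measurable]: "(\<lambda>z. d (fst z) (snd z)) \<in> borel_measurable (T \<Otimes>\<^sub>M T)"
    and d_nonneg: "0 \<le> d a b"
    and d_le: "d a b \<le> w a + w b"
    and d_diff1: "\<bar>d a c - d b c\<bar> \<le> w a + w b"
    and d_diff2: "\<bar>d c a - d c b\<bar> \<le> w a + w b"
begin

lemma d_measurable':
  assumes "sets F = sets T"
  shows "(\<lambda>z. d (fst z) (snd z)) \<in> borel_measurable (F \<Otimes>\<^sub>M F)"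
proof -
  have "sets (F \<Otimes>\<^sub>M F) = sets (T \<Otimes>\<^sub>M T)"
    using assms by (intro sets_pair_measure_cong) auto
  then show ?thesis
    using d_measurable by (subst measurable_cong_sets[of _ "T \<Otimes>\<^sub>M T" _ borel]) auto
qed

lemma pair_mean_measurable[measurable]:
  assumes "S \<subseteq> I"
  shows "(\<lambda>x. pair_mean d x S) \<in> borel_measurable (PiM I (\<lambda>_. T))"
  unfolding pair_mean_def case_prod_beta'
proof (intro borel_measurable_divide borel_measurable_sum borel_measurable_const)
  fix p assume "p \<in> index_pairs S"
  then have "fst p \<in> I" "snd p \<in> I"
    using assms by (auto simp: index_pairs_def)
  then have "(\<lambda>x. (x (fst p), x (snd p))) \<in> measurable (PiM I (\<lambda>_. T)) (T \<Otimes>\<^sub>M T)"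
    by measurable
  from measurable_compose[OF this d_measurable]
  show "(\<lambda>x. d (x (fst p)) (x (snd p))) \<in> borel_measurable (PiM I (\<lambda>_. T))"
    by simp
qed

text \<open>Unbiasedness of the U-statistic: every pair has the same joint law. The case
  \<open>card S < 2\<close>, where the statistic is constantly 0, is the only source of bias in the
  estimator's numerator given the labels.\<close>

lemma integral_pair_mean:
  assumes I: "finite I" "S \<subseteq> I" and F: "\<And>i. exp_moment_le (F i) w s B" "\<And>i. sets (F i) = sets T"
    and G: "\<And>i. i \<in> S \<Longrightarrow> F i = G"
  shows "integrable (PiM I F) (\<lambda>x. pair_mean d x S)" (is ?A)
    "(\<integral>x. pair_mean d x S \<partial>PiM I F) =
        (if card S < 2 then 0 else \<integral>z. d (fst z) (snd z) \<partial>(G \<Otimes>\<^sub>M G))" (is ?B)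
proof -
  let ?E = "\<integral>z. d (fst z) (snd z) \<partial>(G \<Otimes>\<^sub>M G)"
  have S: "finite S"
    using I finite_subset by auto
  have one: "integrable (PiM I F) (\<lambda>x. d (x i) (x j)) \<and> (\<integral>x. d (x i) (x j) \<partial>PiM I F) = ?E"
    if "i \<in> S" "j \<in> S" "i < j" for i j
  proof -
    have eq: "F i = G" "F j = G"
      using G that by auto
    have ij: "i \<in> I" "j \<in> I"
      using that I by auto
    have m: "(\<lambda>x. (x i, x j)) \<in> measurable (PiM I F) (G \<Otimes>\<^sub>M G)"
      using measurable_component_singleton[of i I F] measurable_component_singleton[of j I F] eq ij
      by (auto intro: measurable_Pair)
    have dist: "distr (PiM I F) (G \<Otimes>\<^sub>M G) (\<lambda>x. (x i, x j)) = G \<Otimes>\<^sub>M G"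
      using distr_PiM_pair[of I F i j] I(1) ij that exp_moment_leD(1)[OF F(1)] eq by auto
    have mG: "(\<lambda>z. d (fst z) (snd z)) \<in> borel_measurable (G \<Otimes>\<^sub>M G)"
      using F(2)[of i] eq by (intro d_measurable') auto
    have "integrable (G \<Otimes>\<^sub>M G) (\<lambda>z. d (fst z) (snd z))"
      using exp_moment_le_distance(1)[of G w s B d] F(1)[of i] eq mG d_nonneg d_le by auto
    then show ?thesis
      using integrable_distr_eq[OF m mG] integral_distr[OF m mG] by (simp add: dist)
  qed
  have one': "integrable (PiM I F) (\<lambda>x. d (x (fst p)) (x (snd p)))"
    "(\<integral>x. d (x (fst p)) (x (snd p)) \<partial>PiM I F) = ?E" if "p \<in> index_pairs S" for p
    using one[of "fst p" "snd p"] that by (auto simp: index_pairs_def)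
  show ?A
    unfolding pair_mean_def case_prod_beta' using one' by auto
  have "(\<integral>x. pair_mean d x S \<partial>PiM I F) = (\<Sum>p\<in>index_pairs S. ?E) / real (card S choose 2)"
    unfolding pair_mean_def case_prod_beta' using one' by (simp add: integral_sum)
  then show ?B
    using card_index_pairs[OF S] by auto
qed

text \<open>The label vector \<open>v\<close> is deterministic here. Replacing \<open>x i\<close>
  affects only the class \<open>v i\<close>, and the weight of that class cancels its size, which
  leaves the difference constant \<open>2 / n\<close> for every observation. With a single class
  this is also the concentration of the full pair average.\<close>

lemma classwise_pair_mean_concentration:
  fixes n :: nat and v :: "nat \<Rightarrow> nat" and F :: "nat \<Rightarrow> 'a measure" and K :: "nat set"
  defines "S \<equiv> \<lambda>k. {i \<in> {1..n}. v i = k}"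
  defines "f \<equiv> \<lambda>x. \<Sum>k\<in>K. real (card (S k)) / real n * pair_mean d x (S k)"
  defines "m \<equiv> \<Sum>k\<in>K. real (card (S k)) / real n *
      (if card (S k) < 2 then 0 else \<integral>z. d (fst z) (snd z) \<partial>(F k \<Otimes>\<^sub>M F k))"
  assumes K: "finite K" "\<And>i. v i \<in> K" and n: "1 \<le> n"
    and F: "\<And>k. k \<in> K \<Longrightarrow> exp_moment_le (F k) w s B" "\<And>k. k \<in> K \<Longrightarrow> sets (F k) = sets T"
    and \<theta>: "0 < \<theta>" "\<theta> \<le> s / 4"
  shows "f \<in> borel_measurable (PiM {1..n} (\<lambda>_. T))"
    and "measure (PiM {1..n} (\<lambda>i. F (v i))) {x \<in> space (PiM {1..n} (\<lambda>_. T)). t \<le> \<bar>f x - m\<bar>}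
      \<le> 2 * exp (real n * (16 * B * exp B / s\<^sup>2 * \<theta>\<^sup>2 - \<theta> * t))"
proof -
  let ?F = "\<lambda>i. F (v i)" and ?N = "{1..n}"
  let ?P = "PiM ?N ?F"
  have S: "finite (S k)" "S k \<subseteq> ?N" for k
    by (auto simp: S_def)
  have setsP: "sets ?P = sets (PiM ?N (\<lambda>_. T))"
    using F K by (intro sets_PiM_cong) auto
  note spaceP = sets_eq_imp_space_eq[OF setsP]
  show f: "f \<in> borel_measurable (PiM ?N (\<lambda>_. T))"
    unfolding f_def using S by (intro borel_measurable_sum borel_measurable_times pair_mean_measurable) auto
  have fP: "f \<in> borel_measurable ?P"
    by (subst measurable_cong_sets[OF setsP refl]) (rule f)
  have em: "exp_moment_le (?F i) w s B" "sets (?F i) = sets T" for i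
    using F K by auto
  have G: "?F i = F k" if "i \<in> S k" for i k
    using that by (simp add: S_def)
  have int: "integrable ?P (\<lambda>x. pair_mean d x (S k))"
    "(\<integral>x. pair_mean d x (S k) \<partial>?P) =
      (if card (S k) < 2 then 0 else \<integral>z. d (fst z) (snd z) \<partial>(F k \<Otimes>\<^sub>M F k))" for k
    by (rule integral_pair_mean[OF finite_atLeastAtMost S(2) em G], assumption)+
  have Ef: "(\<integral>x. f x \<partial>?P) = m"
    unfolding f_def m_def using int by (simp add: integral_sum)
  have diff: "\<bar>f (x(i := b)) - f x\<bar> \<le> 2 / real n * (w b + w (x i))" if i: "i \<in> ?N" for x i b
  proof -
    have "f (x(i := b)) - f x = (\<Sum>k\<in>K. real (card (S k)) / real n *
        (pair_mean d (x(i := b)) (S k) - pair_mean d x (S k)))"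
      by (simp add: f_def sum_subtractf[symmetric] right_diff_distrib)
    also have "\<dots> = (\<Sum>k\<in>K. if k = v i then real (card (S k)) / real n *
        (pair_mean d (x(i := b)) (S k) - pair_mean d x (S k)) else 0)"
    proof (intro sum.cong refl)
      fix k
      show "real (card (S k)) / real n * (pair_mean d (x(i := b)) (S k) - pair_mean d x (S k)) =
        (if k = v i then real (card (S k)) / real n *
          (pair_mean d (x(i := b)) (S k) - pair_mean d x (S k)) else 0)"
      proof (cases "k = v i")
        case False
        then have "pair_mean d (x(i := b)) (S k) = pair_mean d x (S k)"
          by (intro pair_mean_cong) (auto simp: S_def)
        with False show ?thesis by simp
      qed simp
    qed
    also have "\<dots> = real (card (S (v i))) / real n *
        (pair_mean d (x(i := b)) (S (v i)) - pair_mean d x (S (v i)))"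
      using K by simp
    finally have "\<bar>f (x(i := b)) - f x\<bar> = real (card (S (v i))) *
        \<bar>pair_mean d (x(i := b)) (S (v i)) - pair_mean d x (S (v i))\<bar> / real n"
      by (simp add: abs_mult)
    also have "\<dots> \<le> 2 * (w b + w (x i)) / real n"
      using i by (intro divide_right_mono pair_mean_bounded_differences[OF d_diff1 d_diff2] S)
        (auto simp: S_def)
    finally show ?thesis
      by simp
  qed
  \<comment> \<open>The Chernoff parameter is \<open>\<theta> * n\<close>. With all
    \<open>a i = 2 / n\<close> its admissibility becomes \<open>\<theta> \<le> s / 4\<close>, and
    the sum of squares is \<open>4 / n\<close>, which turns the constant 4 into 16.\<close>
  have "measure ?P {x \<in> space ?P. t \<le> \<bar>f x - (\<integral>x. f x \<partial>?P)\<bar>}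
      \<le> 2 * exp (4 * B * exp B / s\<^sup>2 * (\<theta> * real n)\<^sup>2 * (\<Sum>i\<in>?N. (2 / real n)\<^sup>2) - \<theta> * real n * t)"
    using \<theta> n diff by (intro prob_bounded_differences[where w = w] em fP) auto
  also have "4 * B * exp B / s\<^sup>2 * (\<theta> * real n)\<^sup>2 * (\<Sum>i\<in>?N. (2 / real n)\<^sup>2) - \<theta> * real n * t
      = real n * (16 * B * exp B / s\<^sup>2 * \<theta>\<^sup>2 - \<theta> * t)"
    using n by (simp add: field_simps power2_eq_square)
  finally show "measure ?P {x \<in> space (PiM ?N (\<lambda>_. T)). t \<le> \<bar>f x - m\<bar>}
      \<le> 2 * exp (real n * (16 * B * exp B / s\<^sup>2 * \<theta>\<^sup>2 - \<theta> * t))"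
    unfolding Ef spaceP .
qed

end

text \<open>A bounded variable is treated as one with constant weight \<open>b\<close>, whose
  exponential moment is \<open>exp (s * b)\<close>. The range up to \<open>2 * b\<close> matches the
  bound \<open>2 * B / s\<close> on the conditional Gini mean differences when
  \<open>b = B / s\<close>.\<close>

lemma bounded_mean_concentration:
  fixes h :: "'a \<Rightarrow> real"
  assumes D: "prob_space D" and h[measurable]: "h \<in> borel_measurable D"
    and osc: "\<And>x. x \<in> space D \<Longrightarrow> 0 \<le> h x \<and> h x \<le> 2 * b" and b: "0 \<le> b" and s: "0 < s"
    and B: "exp (s * b) \<le> B" and n: "1 \<le> n" and \<theta>: "0 < \<theta>" "\<theta> \<le> s / 4"
  shows "measure (PiM {1..n} (\<lambda>_. D))
      {z \<in> space (PiM {1..n} (\<lambda>_. D)). t \<le> \<bar>(\<Sum>i=1..n. h (z i)) / real n - (\<integral>x. h x \<partial>D)\<bar>}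
    \<le> 2 * exp (real n * (16 * B * exp B / s\<^sup>2 * \<theta>\<^sup>2 - \<theta> * t))"
proof -
  let ?N = "{1..n}" let ?P = "PiM ?N (\<lambda>_. D)"
  interpret D: prob_space D by (rule D)
  define f where "f z = (\<Sum>i=1..n. h (z i)) / real n" for z
  have em: "exp_moment_le D (\<lambda>_. b) s B"
    using B b s D order_trans[OF exp_ge_zero B]
    by (auto simp: exp_moment_le_def D.emeasure_space_1 intro!: ennreal_leI)
  have int: "integrable D h"
    using osc b by (intro D.integrable_const_bound[of _ "2 * b"]) (auto intro!: AE_I2)
  have f[measurable]: "f \<in> borel_measurable ?P"
    unfolding f_def by measurable
  have Ef: "(\<integral>z. f z \<partial>?P) = (\<integral>x. h x \<partial>D)"
  proof -
    have c: "integrable ?P (\<lambda>z. h (z i)) \<and> (\<integral>z. h (z i) \<partial>?P) = (\<integral>x. h x \<partial>D)" if "i \<in> ?N" for i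
      using that int integrable_distr_eq[of "\<lambda>z. z i" ?P D h] integral_distr[of "\<lambda>z. z i" ?P D h]
        distr_PiM_component[of ?N "\<lambda>_. D" i] D by auto
    then have "(\<integral>z. (\<Sum>i=1..n. h (z i)) \<partial>?P) = (\<Sum>i=1..n. \<integral>x. h x \<partial>D)"
      by (subst Bochner_Integration.integral_sum) auto
    then show ?thesis
      using n by (simp add: f_def)
  qed
  have diff: "\<bar>f (z(i := x)) - f z\<bar> \<le> 2 / real n * (b + b)"
    if z: "z \<in> space ?P" and i: "i \<in> ?N" and x: "x \<in> space D" for z i x
  proof -
    have "(\<Sum>j=1..n. h ((z(i := x)) j)) - (\<Sum>j=1..n. h (z j)) = (\<Sum>j=1..n. if j = i then h x - h (z i) else 0)"
      unfolding sum_subtractf[symmetric] by (intro sum.cong) auto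
    also have "\<dots> = h x - h (z i)"
      using i by simp
    finally have eq: "f (z(i := x)) - f z = (h x - h (z i)) / real n"
      by (simp add: f_def diff_divide_distrib[symmetric])
    have "z i \<in> space D"
      using z i by (auto simp: space_PiM PiE_iff)
    \<comment> \<open>The factor 2 is slack: with difference constant \<open>2 / n\<close> the
      exponent is literally that of the pair averages.\<close>
    then have "\<bar>h x - h (z i)\<bar> \<le> 2 * (b + b)"
      using osc[of "z i"] osc[OF x] by (auto simp: abs_le_iff)
    then show ?thesis
      by (simp add: eq abs_divide divide_right_mono)
  qed
  have "measure ?P {z \<in> space ?P. t \<le> \<bar>f z - (\<integral>z. f z \<partial>?P)\<bar>}
      \<le> 2 * exp (4 * B * exp B / s\<^sup>2 * (\<theta> * real n)\<^sup>2 * (\<Sum>i\<in>?N. (2 / real n)\<^sup>2) - \<theta> * real n * t)"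
    using \<theta> n diff by (intro prob_bounded_differences[where w = "\<lambda>_. b"] em f) auto
  also have "4 * B * exp B / s\<^sup>2 * (\<theta> * real n)\<^sup>2 * (\<Sum>i\<in>?N. (2 / real n)\<^sup>2) - \<theta> * real n * t
      = real n * (16 * B * exp B / s\<^sup>2 * \<theta>\<^sup>2 - \<theta> * t)"
    using n by (simp add: field_simps power2_eq_square)
  finally show ?thesis
    unfolding Ef unfolding f_def .
qed

section \<open>Deterministic bounds for the ratio and for classes observed once\<close>

text \<open>The difference of the ratios equals
  \<open>(g - g') / a' + g * (a' - a) / (a * a')\<close>. Since \<open>t \<le> \<delta> / 2\<close>,
  the perturbed denominator \<open>a'\<close> stays above \<open>\<delta> / 2\<close>, which yields
  the constants \<open>6 / \<delta>\<close> and \<open>2 * u / \<delta>\<^sup>2\<close>.\<close>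

lemma ratio_error:
  fixes a a' g g' t \<delta> u :: real
  assumes "\<bar>a' - a\<bar> < t" "\<bar>g' - g\<bar> < 3 * t" "\<delta> \<le> a" "0 < \<delta>" "t \<le> \<delta> / 2" "0 \<le> g" "g \<le> u"
  shows "\<bar>(a' - g') / a' - (a - g) / a\<bar> < t * (6 / \<delta> + 2 * u / \<delta>\<^sup>2)"
proof -
  have t: "0 < t"
    using assms(1) by linarith
  have a': "\<delta> / 2 < a'" and a: "0 < a"
    using assms by linarith+
  have pos: "0 < a'"
    using a' assms(4) by linarith
  have "(a' - g') / a' - (a - g) / a = (g - g') / a' + g * (a' - a) / (a * a')"
    using a pos by (simp add: field_simps)
  then have "\<bar>(a' - g') / a' - (a - g) / a\<bar> \<le> \<bar>g' - g\<bar> / a' + g * \<bar>a' - a\<bar> / (a * a')"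
    using a pos assms(6) abs_triangle_ineq[of "(g - g') / a'" "g * (a' - a) / (a * a')"]
    by (simp add: abs_mult abs_divide abs_minus_commute)
  also have "\<bar>g' - g\<bar> / a' < 3 * t / (\<delta> / 2)"
    using assms a' t by (intro frac_less) auto
  also have "g * \<bar>a' - a\<bar> / (a * a') \<le> u * t / (\<delta> * (\<delta> / 2))"
    using assms a' t by (intro frac_le mult_mono) (auto intro!: mult_nonneg_nonneg mult_pos_pos)
  finally show ?thesis
    by (simp add: field_simps power2_eq_square)
qed

text \<open>Only \<open>c = 1\<close> contributes: for \<open>c = 0\<close> both terms vanish, and
  for \<open>c \<ge> 2\<close> they coincide.\<close>

lemma truncated_class_bias:
  fixes g u N :: real
  assumes "0 \<le> g" "g \<le> u" "0 < N"
  shows "\<bar>real c / N * (if c < 2 then 0 else g) - real c * g / N\<bar> \<le> u / N"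
proof (cases "c < 2")
  case True
  then have "real c * g \<le> 1 * u"
    using assms by (intro mult_mono) auto
  with True show ?thesis
    using assms by (simp add: divide_right_mono)
qed (use assms in simp)

text \<open>Grouping the sample by label turns the average of \<open>g (v i)\<close> into a sum over
  classes, and each of the \<open>card K\<close> classes loses at most \<open>u / n\<close> by
  truncation.\<close>

lemma class_mean_bias:
  fixes u :: real
  assumes n: "1 \<le> n" and u: "\<And>k. k \<in> K \<Longrightarrow> 0 \<le> g k \<and> g k \<le> u"
    and v: "\<And>i. i \<in> {1..n} \<Longrightarrow> v i \<in> K" and K: "finite K"
  shows "\<bar>(\<Sum>k\<in>K. real (card {i \<in> {1..n}. v i = k}) / real n *
      (if card {i \<in> {1..n}. v i = k} < 2 then 0 else g k))
     - (\<Sum>i=1..n. g (v i)) / real n\<bar> \<le> real (card K) * u / real n"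
proof -
  define c where "c k = card {i \<in> {1..n}. v i = k}" for k
  define b where "b k = real (c k) / real n * (if c k < 2 then 0 else g k) - real (c k) * g k / real n" for k
  have b: "\<bar>b k\<bar> \<le> u / real n" if "k \<in> K" for k
    unfolding b_def using u[OF that] n by (intro truncated_class_bias) auto
  have "(\<Sum>i=1..n. g (v i)) = (\<Sum>k\<in>K. \<Sum>i\<in>{i \<in> {1..n}. v i = k}. g (v i))"
    using v K by (intro sum.group[symmetric] finite_atLeastAtMost image_subsetI)
  also have "\<dots> = (\<Sum>k\<in>K. real (c k) * g k)"
  proof (rule sum.cong[OF refl])
    fix k
    have "(\<Sum>i\<in>{i \<in> {1..n}. v i = k}. g (v i)) = (\<Sum>i\<in>{i \<in> {1..n}. v i = k}. g k)"
      by (rule sum.cong) auto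
    then show "(\<Sum>i\<in>{i \<in> {1..n}. v i = k}. g (v i)) = real (c k) * g k"
      by (simp only: sum_constant c_def)
  qed
  finally have "(\<Sum>k\<in>K. real (c k) / real n * (if c k < 2 then 0 else g k))
     - (\<Sum>i=1..n. g (v i)) / real n = (\<Sum>k\<in>K. b k)"
    by (simp only: b_def sum_divide_distrib sum_subtractf)
  moreover have "\<bar>\<Sum>k\<in>K. b k\<bar> \<le> (\<Sum>k\<in>K. u / real n)"
    using b by (intro order_trans[OF sum_abs] sum_mono) auto
  ultimately show ?thesis
    by (simp add: c_def)
qed

section \<open>A group of a population\<close>

text \<open>The difference conditions follow from the triangle inequality through the exchanged
  point: \<open>\<bar>d a c - d b c\<bar> \<le> d a b\<close>, and \<open>d a b\<close> is at most
  the sum of the norms.\<close>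

lemma group_dist_pair_kernel:
  assumes "finite I"
  shows "pair_kernel (\<Pi>\<^sub>M i\<in>I. borel) (\<lambda>x. L2_set x I) (group_dist I)"
proof
  show "(\<lambda>z. group_dist I (fst z) (snd z)) \<in> borel_measurable ((\<Pi>\<^sub>M i\<in>I. borel) \<Otimes>\<^sub>M (\<Pi>\<^sub>M i\<in>I. borel))"
    unfolding group_dist_def L2_set_def by measurable
  have neg: "L2_set (\<lambda>i. - f i) I = L2_set f I" for f :: "nat \<Rightarrow> real"
    by (simp add: L2_set_def)
  have le: "group_dist I a b \<le> L2_set a I + L2_set b I" for a b
    using L2_set_triangle_ineq[of a "\<lambda>i. - b i" I] by (simp add: group_dist_def neg)
  have sym: "group_dist I a b = group_dist I b a" for a b
    using neg[of "\<lambda>i. a i - b i"] by (simp add: group_dist_def)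
  have tri: "group_dist I a c \<le> group_dist I a b + group_dist I b c" for a b c
    using L2_set_triangle_ineq[of "\<lambda>i. a i - b i" "\<lambda>i. b i - c i" I] by (simp add: group_dist_def)
  show diff: "\<bar>group_dist I a c - group_dist I b c\<bar> \<le> L2_set a I + L2_set b I" for a b c
    using tri[of a c b] tri[of b c a] le[of a b] sym[of a b] by (simp add: abs_le_iff)
  show "\<bar>group_dist I c a - group_dist I c b\<bar> \<le> L2_set a I + L2_set b I" for a b c
    using diff[of a c b] by (simp add: sym)
  show "0 \<le> group_dist I a b" for a b
    by (simp add: group_dist_def)
  show "group_dist I a b \<le> L2_set a I + L2_set b I" for a b
    by (rule le)
qed

abbreviation (input) group_proj :: "population \<Rightarrow> nat \<Rightarrow> (nat \<Rightarrow> real) \<times> nat \<Rightarrow> nat \<Rightarrow> real" where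
  "group_proj P l z \<equiv> restrict (fst z) (group P l)"

lemma mean_pair_dist_eq_pair_mean:
  "mean_pair_dist P z l S = pair_mean (group_dist (group P l)) (\<lambda>i. fst (z i)) S"
  by (simp add: mean_pair_dist_def pair_mean_def index_pairs_def)

lemma mean_pair_dist_eq_proj:
  assumes "S \<subseteq> {1..n}"
  shows "mean_pair_dist P z l S =
    pair_mean (group_dist (group P l)) (\<lambda>i\<in>{1..n}. group_proj P l (z i)) S"
proof -
  have "group_dist I (restrict a I) (restrict b I) = group_dist I a b" for I a b
    unfolding group_dist_def by (intro L2_set_cong) auto
  then show ?thesis
    unfolding mean_pair_dist_eq_pair_mean pair_mean_def using assms
    by (intro arg_cong2[where f = "(/)"] sum.cong) (auto simp: index_pairs_def subset_iff)
qed

text \<open>Samples are total functions, while points of the product space are undefined outside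
  \<open>{1..n}\<close>; this identifies the two.\<close>

lemma gini_cor_hat_restrict: "gini_cor_hat P n (restrict z {1..n}) l = gini_cor_hat P n z l"
proof -
  have "class_indices (restrict z {1..n}) n k = class_indices z n k" for k
    by (auto simp: class_indices_def)
  moreover have "mean_pair_dist P (restrict z {1..n}) l S = mean_pair_dist P z l S" if "S \<subseteq> {1..n}" for S
    unfolding mean_pair_dist_eq_pair_mean using that by (intro pair_mean_cong) auto
  moreover have "class_indices z n k \<subseteq> {1..n}" for k
    by (auto simp: class_indices_def)
  ultimately show ?thesis
    by (simp add: gini_cor_hat_def)
qed

locale population_group =
  fixes P :: population and l :: nat
  assumes valid: "valid_population P" and l: "l \<in> {1..ngroups P}"
begin

abbreviation "grp \<equiv> group P l"
abbreviation "T \<equiv> \<Pi>\<^sub>M i\<in>grp. (borel :: real measure)"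
abbreviation "labels \<equiv> {1..nclasses P}"
abbreviation "nrm x \<equiv> L2_set x grp"

sublocale D: prob_space "law P"
  using valid by (simp add: valid_population_def)

lemma grp_subset: "grp \<subseteq> {1..dim P}"
  using valid l by (auto simp: valid_population_def)

lemma finite_grp: "finite grp"
  using grp_subset finite_subset by auto

sublocale pair_kernel T "\<lambda>x. nrm x" "group_dist grp"
  by (rule group_dist_pair_kernel[OF finite_grp])

lemma sets_law: "sets (law P) = sets (covariate_space P \<Otimes>\<^sub>M count_space labels)"
  using valid by (simp add: valid_population_def)

lemma space_law: "space (law P) = space (covariate_space P) \<times> labels"
  using sets_eq_imp_space_eq[OF sets_law] by (simp add: space_pair_measure)

lemma label_in: "z \<in> space (law P) \<Longrightarrow> snd z \<in> labels"
  by (auto simp: space_law)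

lemma label_measurable[measurable]: "snd \<in> measurable (law P) (count_space labels)"
  by (subst measurable_cong_sets[OF sets_law refl]) simp

lemma proj_measurable[measurable]: "group_proj P l \<in> measurable (law P) T"
  unfolding measurable_cong_sets[OF sets_law refl] covariate_space_def
proof (rule measurable_restrict)
  fix i assume "i \<in> grp"
  then have "i \<in> {1..dim P}"
    using grp_subset by auto
  then show "(\<lambda>z. fst z i) \<in> borel_measurable ((\<Pi>\<^sub>M i\<in>{1..dim P}. borel) \<Otimes>\<^sub>M count_space labels)"
    by measurable
qed

lemma class_event_sets[measurable]: "class_event P k \<in> sets (law P)"
proof -
  have "class_event P k = snd -` ({k} \<inter> labels) \<inter> space (law P)"
    using label_in by (auto simp: class_event_def)
  also have "\<dots> \<in> sets (law P)"
    by (rule measurable_sets[OF label_measurable]) auto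
  finally show ?thesis .
qed

lemma class_prob_pos: "k \<in> labels \<Longrightarrow> 0 < class_prob P k"
  using valid by (simp add: valid_population_def)

lemma one_in_labels: "1 \<in> labels"
  using valid by (simp add: valid_population_def)

lemma emeasure_class_event: "emeasure (law P) (class_event P k) = ennreal (class_prob P k)"
  by (simp add: class_prob_def D.emeasure_eq_measure)

section \<open>The group law as a mixture of the class laws\<close>

lemma sum_indicator_class_event:
  "z \<in> space (law P) \<Longrightarrow> (\<Sum>k\<in>labels. indicator (class_event P k) z) = (1 :: 'b :: semiring_1)"
  using label_in[of z] by (simp add: class_event_def indicator_def sum.delta)

lemma sum_class_prob: "(\<Sum>k\<in>labels. class_prob P k) = 1"
proof -
  have "(\<Sum>k\<in>labels. class_prob P k) = (\<Sum>k\<in>labels. \<integral>z. indicator (class_event P k) z \<partial>law P)"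
    by (simp add: class_prob_def)
  also have "\<dots> = (\<integral>z. (\<Sum>k\<in>labels. indicator (class_event P k) z) \<partial>law P)"
    by (rule Bochner_Integration.integral_sum[symmetric]) (simp add: D.emeasure_eq_measure)
  also have "\<dots> = (\<integral>z. 1 \<partial>law P)"
    by (intro Bochner_Integration.integral_cong refl sum_indicator_class_event)
  finally show ?thesis
    by (simp add: D.prob_space)
qed

lemma nn_integral_class_event:
  assumes [measurable]: "f \<in> borel_measurable T" and k: "k \<in> labels"
  shows "(\<integral>\<^sup>+z. f (group_proj P l z) * indicator (class_event P k) z \<partial>law P)
    = ennreal (class_prob P k) * (\<integral>\<^sup>+x. f x \<partial>cond_group_law P l k)"
proof -
  have "(\<integral>\<^sup>+x. f x \<partial>cond_group_law P l k)
      = (\<integral>\<^sup>+z. f (group_proj P l z) * indicator (class_event P k) z \<partial>law P) / ennreal (class_prob P k)"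
    unfolding cond_group_law_def emeasure_class_event[symmetric]
    by (simp add: nn_integral_distr nn_integral_uniform_measure)
  moreover have "ennreal (class_prob P k) * (X / ennreal (class_prob P k)) = X" for X
    unfolding ennreal_times_divide using class_prob_pos[OF k]
    by (subst mult.commute) (rule mult_divide_eq_ennreal, auto)
  ultimately show ?thesis
    by simp
qed

lemma nn_integral_group_law:
  assumes [measurable]: "f \<in> borel_measurable T"
  shows "(\<integral>\<^sup>+x. f x \<partial>group_law P l)
    = (\<Sum>k\<in>labels. ennreal (class_prob P k) * (\<integral>\<^sup>+x. f x \<partial>cond_group_law P l k))"
proof -
  have "(\<integral>\<^sup>+x. f x \<partial>group_law P l) = (\<integral>\<^sup>+z. f (group_proj P l z) \<partial>law P)"
    unfolding group_law_def by (simp add: nn_integral_distr)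
  also have "\<dots> = (\<integral>\<^sup>+z. (\<Sum>k\<in>labels. f (group_proj P l z) * indicator (class_event P k) z) \<partial>law P)"
    by (intro nn_integral_cong) (simp add: sum_distrib_left[symmetric] sum_indicator_class_event del: One_nat_def)
  also have "\<dots> = (\<Sum>k\<in>labels. \<integral>\<^sup>+z. f (group_proj P l z) * indicator (class_event P k) z \<partial>law P)"
    by (rule nn_integral_sum) measurable
  finally show ?thesis
    by (simp add: nn_integral_class_event)
qed

lemma nrm_measurable[measurable]: "(\<lambda>x. nrm x) \<in> borel_measurable T"
  unfolding L2_set_def by measurable

lemma sets_cond_group_law: "sets (cond_group_law P l k) = sets T"
  by (simp add: cond_group_law_def)

lemma sets_group_law: "sets (group_law P l) = sets T"
  by (simp add: group_law_def)

lemma exp_moment_cond_group_law: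
  assumes "k \<in> labels" "0 < s" "0 \<le> B"
    and "(\<integral>\<^sup>+ x. ennreal (exp (s * nrm x)) \<partial>cond_group_law P l k) \<le> ennreal B"
  shows "exp_moment_le (cond_group_law P l k) (\<lambda>x. nrm x) s B"
proof -
  have "prob_space (cond_group_law P l k)"
    unfolding cond_group_law_def using class_prob_pos[OF assms(1)]
    by (intro prob_space.prob_space_distr prob_space_uniform_measure) (auto simp: emeasure_class_event)
  moreover have "(\<lambda>x. nrm x) \<in> borel_measurable (cond_group_law P l k)"
    by (subst measurable_cong_sets[OF sets_cond_group_law refl]) measurable
  ultimately show ?thesis
    using assms by (simp add: exp_moment_le_def)
qed

text \<open>The moment condition concerns the class laws. Since the group law is their mixture with
  weights that sum to 1, it inherits the same bound \<open>B\<close>.\<close>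

lemma exp_moment_group_law:
  assumes "0 < s" "0 \<le> B"
    and "\<And>k. k \<in> labels \<Longrightarrow> (\<integral>\<^sup>+ x. ennreal (exp (s * nrm x)) \<partial>cond_group_law P l k) \<le> ennreal B"
  shows "exp_moment_le (group_law P l) (\<lambda>x. nrm x) s B"
proof -
  have "prob_space (group_law P l)"
    unfolding group_law_def by (intro D.prob_space_distr) measurable
  moreover have "(\<lambda>x. nrm x) \<in> borel_measurable (group_law P l)"
    by (subst measurable_cong_sets[OF sets_group_law refl]) measurable
  moreover have "(\<integral>\<^sup>+ x. ennreal (exp (s * nrm x)) \<partial>group_law P l)
      \<le> (\<Sum>k\<in>labels. ennreal (class_prob P k) * ennreal B)"
    using assms(3) by (subst nn_integral_group_law) (auto intro!: sum_mono mult_left_mono)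
  moreover have "(\<Sum>k\<in>labels. ennreal (class_prob P k) * ennreal B) = ennreal B"
    using sum_class_prob class_prob_pos assms(2)
    by (simp add: ennreal_mult[symmetric] less_imp_le sum_distrib_right[symmetric] sum_ennreal
        class_prob_def)
  ultimately show ?thesis
    using assms by (simp add: exp_moment_le_def)
qed

subsection \<open>Concentration of the estimator\<close>

text \<open>The labels \<open>v\<close> and the covariates \<open>x\<close> are separate arguments,
  so that the labels can be frozen while the covariates remain random.\<close>

definition class_mean :: "nat \<Rightarrow> (nat \<Rightarrow> nat) \<Rightarrow> (nat \<Rightarrow> nat \<Rightarrow> real) \<Rightarrow> real" where
  "class_mean n v x = (\<Sum>k\<in>labels. real (card {i \<in> {1..n}. v i = k}) / real n *
      pair_mean (group_dist grp) x {i \<in> {1..n}. v i = k})"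

text \<open>Outside \<open>{1..n}\<close> the default is the label 1, which always belongs to a
  class; thus every value is a label.\<close>

definition sample_labels :: "nat \<Rightarrow> (nat \<Rightarrow> (nat \<Rightarrow> real) \<times> nat) \<Rightarrow> nat \<Rightarrow> nat" where
  "sample_labels n z = (\<lambda>i. if i \<in> {1..n} then snd (z i) else 1)"

definition sample_proj :: "nat \<Rightarrow> (nat \<Rightarrow> (nat \<Rightarrow> real) \<times> nat) \<Rightarrow> nat \<Rightarrow> nat \<Rightarrow> real" where
  "sample_proj n z = (\<lambda>i\<in>{1..n}. group_proj P l (z i))"

abbreviation "full_mean n x \<equiv> pair_mean (group_dist grp) x {1..n}"

lemma gini_cor_hat_eq:
  "gini_cor_hat P n z l =
    (full_mean n (sample_proj n z) - class_mean n (sample_labels n z) (sample_proj n z))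
      / full_mean n (sample_proj n z)"
proof -
  have "class_indices z n k = {i \<in> {1..n}. sample_labels n z i = k}" for k
    by (auto simp: class_indices_def sample_labels_def)
  moreover have S: "mean_pair_dist P z l S = pair_mean (group_dist grp) (sample_proj n z) S" if "S \<subseteq> {1..n}" for S
    unfolding sample_proj_def by (rule mean_pair_dist_eq_proj[OF that])
  moreover have "mean_pair_dist P z l {i \<in> {1..n}. sample_labels n z i = k}
      = pair_mean (group_dist grp) (sample_proj n z) {i \<in> {1..n}. sample_labels n z i = k}" for k
    by (rule S) auto
  ultimately show ?thesis
    by (simp only: gini_cor_hat_def class_mean_def order_refl)
qed

lemma class_mean_measurable[measurable]:
  "class_mean n v \<in> borel_measurable (PiM {1..n} (\<lambda>_. T))"
  unfolding class_mean_def[abs_def]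
  by (intro borel_measurable_sum borel_measurable_times borel_measurable_const pair_mean_measurable) auto

lemma sets_sample_event:
  assumes "\<And>v. (\<And>i. v i \<in> labels) \<Longrightarrow> A v \<in> sets (PiM {1..n} (\<lambda>_. T))"
  shows "{z \<in> space (PiM {1..n} (\<lambda>_. law P)). sample_proj n z \<in> A (sample_labels n z)}
    \<in> sets (PiM {1..n} (\<lambda>_. law P))"
  unfolding sample_proj_def sample_labels_def
proof (rule sets_PiM_labelled[where K = labels and T = T])
  show "{z \<in> space (law P). snd z = k} \<in> sets (law P)" for k
    using class_event_sets[of k] by (simp only: class_event_def)
qed (fact finite_atLeastAtMost proj_measurable one_in_labels label_in assms)+

lemma measure_sample_event:
  assumes "\<And>v. (\<And>i. v i \<in> labels) \<Longrightarrow> A v \<in> sets (PiM {1..n} (\<lambda>_. T))"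
    and "\<And>v. (\<And>i. v i \<in> labels) \<Longrightarrow>
         measure (PiM {1..n} (\<lambda>i. cond_group_law P l (v i))) (A v) \<le> b"
  shows "measure (PiM {1..n} (\<lambda>_. law P))
    {z \<in> space (PiM {1..n} (\<lambda>_. law P)). sample_proj n z \<in> A (sample_labels n z)} \<le> b"
  unfolding sample_proj_def sample_labels_def
proof (rule measure_PiM_conditional_bound[where K = labels and T = T])
  show "{z \<in> space (law P). snd z = k} \<in> sets (law P)" for k
    using class_event_sets[of k] by (simp only: class_event_def)
  show "0 < measure (law P) {z \<in> space (law P). snd z = k}" if "k \<in> labels" for k
    using class_prob_pos[OF that] by (simp only: class_prob_def class_event_def)
  show "measure (PiM {1..n} (\<lambda>i. distr (uniform_measure (law P) {z \<in> space (law P). snd z = v i}) T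
      (group_proj P l))) (A v) \<le> b" if "\<And>i. v i \<in> labels" for v
    using assms(2)[OF that] by (simp only: cond_group_law_def class_event_def)
qed (fact finite_atLeastAtMost proj_measurable one_in_labels label_in assms(1) D.prob_space_axioms)+

lemma sample_proj_in_space:
  "z \<in> space (PiM {1..n} (\<lambda>_. law P)) \<Longrightarrow> sample_proj n z \<in> space (PiM {1..n} (\<lambda>_. T))"
  unfolding sample_proj_def using measurable_space[OF proj_measurable]
  by (auto simp: space_PiM PiE_iff)

text \<open>The index sets of the classes are random. For frozen labels the estimator is the
  measurable function \<open>stat v\<close> of the projected sample, and there are finitely many
  label vectors.\<close>

lemma gini_cor_hat_measurable:
  "(\<lambda>z. gini_cor_hat P n z l) \<in> borel_measurable (PiM {1..n} (\<lambda>_. law P))"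
proof (rule measurableI)
  fix B :: "real set" assume [measurable]: "B \<in> sets borel"
  define stat where "stat v x = (full_mean n x - class_mean n v x) / full_mean n x" for v x
  have [measurable]: "full_mean n \<in> borel_measurable (PiM {1..n} (\<lambda>_. T))"
    by (rule pair_mean_measurable) auto
  have [measurable]: "stat v \<in> borel_measurable (PiM {1..n} (\<lambda>_. T))" for v
    unfolding stat_def by measurable
  have "(\<lambda>z. gini_cor_hat P n z l) -` B \<inter> space (PiM {1..n} (\<lambda>_. law P)) =
      {z \<in> space (PiM {1..n} (\<lambda>_. law P)). sample_proj n z \<in>
         stat (sample_labels n z) -` B \<inter> space (PiM {1..n} (\<lambda>_. T))}"
    using sample_proj_in_space by (auto simp: gini_cor_hat_eq stat_def)
  also have "\<dots> \<in> sets (PiM {1..n} (\<lambda>_. law P))"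
    by (rule sets_sample_event) measurable
  finally show "(\<lambda>z. gini_cor_hat P n z l) -` B \<inter> space (PiM {1..n} (\<lambda>_. law P))
    \<in> sets (PiM {1..n} (\<lambda>_. law P))" .
qed simp

lemma cond_gini_delta_bounds:
  assumes "exp_moment_le (cond_group_law P l k) (\<lambda>x. nrm x) s B"
  shows "0 \<le> cond_gini_delta P l k" "cond_gini_delta P l k \<le> 2 * B / s"
  using exp_moment_le_distance(2,3)[OF assms d_measurable'[OF sets_cond_group_law] d_nonneg d_le]
  by (simp_all add: cond_gini_delta_def mean_difference_def)

text \<open>Presents the within-class part of the numerator of \<open>gini_cor\<close> as the mean
  of the bounded variable \<Delta>_{l|Y}, to which the concentration of bounded means
  applies.\<close>

lemma integral_cond_gini_delta:
  shows "(\<lambda>z. cond_gini_delta P l (snd z)) \<in> borel_measurable (law P)"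
    and "(\<integral>z. cond_gini_delta P l (snd z) \<partial>law P) = (\<Sum>k\<in>labels. class_prob P k * cond_gini_delta P l k)"
proof -
  show "(\<lambda>z. cond_gini_delta P l (snd z)) \<in> borel_measurable (law P)"
    by (rule measurable_compose[OF label_measurable]) simp
  have "(\<integral>z. cond_gini_delta P l (snd z) \<partial>law P)
      = (\<integral>z. (\<Sum>k\<in>labels. indicator (class_event P k) z * cond_gini_delta P l k) \<partial>law P)"
  proof (rule Bochner_Integration.integral_cong[OF refl])
    fix z assume z: "z \<in> space (law P)"
    have "(\<Sum>k\<in>labels. indicator (class_event P k) z * cond_gini_delta P l k)
        = (\<Sum>k\<in>labels. if k = snd z then cond_gini_delta P l k else 0)"
      using z by (intro sum.cong) (auto simp: class_event_def)
    then show "cond_gini_delta P l (snd z) = (\<Sum>k\<in>labels. indicator (class_event P k) z * cond_gini_delta P l k)"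
      using label_in[OF z] by simp
  qed
  also have "\<dots> = (\<Sum>k\<in>labels. \<integral>z. indicator (class_event P k) z * cond_gini_delta P l k \<partial>law P)"
    by (rule Bochner_Integration.integral_sum) (simp add: D.emeasure_eq_measure)
  finally show "(\<integral>z. cond_gini_delta P l (snd z) \<partial>law P) = (\<Sum>k\<in>labels. class_prob P k * cond_gini_delta P l k)"
    by (simp add: class_prob_def)
qed

lemma distr_sample_proj:
  "distr (PiM {1..n} (\<lambda>_. law P)) (PiM {1..n} (\<lambda>_. T)) (sample_proj n) = PiM {1..n} (\<lambda>_. group_law P l)"
proof -
  have p: "prob_space (group_law P l)"
    unfolding group_law_def by (intro D.prob_space_distr) measurable
  have m: "group_proj P l \<in> measurable (law P) (group_law P l)"
    by (subst measurable_cong_sets[OF refl sets_group_law]) (rule proj_measurable)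
  have "distr (PiM {1..n} (\<lambda>_. law P)) (PiM {1..n} (\<lambda>_. group_law P l)) (compose {1..n} (group_proj P l))
      = PiM {1..n} (\<lambda>_. distr (law P) (group_law P l) (group_proj P l))"
    by (rule distr_PiM_finite_prob_space') (auto intro: p m D.prob_space_axioms)
  also have "distr (law P) (group_law P l) (group_proj P l) = distr (law P) T (group_proj P l)"
    by (rule distr_cong) (auto simp: sets_group_law)
  also have "\<dots> = group_law P l"
    by (simp add: group_law_def)
  also have "distr (PiM {1..n} (\<lambda>_. law P)) (PiM {1..n} (\<lambda>_. group_law P l)) (compose {1..n} (group_proj P l))
      = distr (PiM {1..n} (\<lambda>_. law P)) (PiM {1..n} (\<lambda>_. T)) (sample_proj n)"
    by (rule distr_cong)
      (auto intro!: sets_PiM_cong simp: sets_group_law sample_proj_def compose_def)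
  finally show ?thesis .
qed

lemma sample_proj_measurable[measurable]:
  "sample_proj n \<in> measurable (PiM {1..n} (\<lambda>_. law P)) (PiM {1..n} (\<lambda>_. T))"
  unfolding sample_proj_def[abs_def] by measurable

text \<open>No conditioning takes place here: without regard to labels the projected observations
  are i.i.d. from \<open>group_law P l\<close>.\<close>

lemma full_mean_concentration:
  assumes n: "2 \<le> n" and F: "exp_moment_le (group_law P l) (\<lambda>x. nrm x) s B"
    and \<theta>: "0 < \<theta>" "\<theta> \<le> s / 4"
  shows "measure (PiM {1..n} (\<lambda>_. law P)) {z \<in> space (PiM {1..n} (\<lambda>_. law P)).
      t \<le> \<bar>full_mean n (sample_proj n z) - gini_delta P l\<bar>}
    \<le> 2 * exp (real n * (16 * B * exp B / s\<^sup>2 * \<theta>\<^sup>2 - \<theta> * t))"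
proof -
  have [measurable]: "full_mean n \<in> borel_measurable (PiM {1..n} (\<lambda>_. T))"
    by (rule pair_mean_measurable) auto
  let ?A = "{x \<in> space (PiM {1..n} (\<lambda>_. T)). t \<le> \<bar>full_mean n x - gini_delta P l\<bar>}"
  have "measure (PiM {1..n} (\<lambda>_. law P)) {z \<in> space (PiM {1..n} (\<lambda>_. law P)).
      t \<le> \<bar>full_mean n (sample_proj n z) - gini_delta P l\<bar>}
    = measure (PiM {1..n} (\<lambda>_. law P)) (sample_proj n -` ?A \<inter> space (PiM {1..n} (\<lambda>_. law P)))"
    using sample_proj_in_space by (intro arg_cong2[where f = measure]) auto
  also have "\<dots> = measure (PiM {1..n} (\<lambda>_. group_law P l)) ?A"
    unfolding distr_sample_proj[symmetric] using sample_proj_measurable[of n] by (subst measure_distr) auto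
  also have "\<dots> \<le> 2 * exp (real n * (16 * B * exp B / s\<^sup>2 * \<theta>\<^sup>2 - \<theta> * t))"
  proof -
    have "{i. Suc 0 \<le> i \<and> i \<le> n} = {Suc 0..n}"
      by auto
    then show ?thesis
      \<comment> \<open>One artificial class 0 holds all observations. Its weight is
        \<open>n / n = 1\<close>, and \<open>n \<ge> 2\<close> keeps its mean from being truncated
        to 0.\<close>
      using classwise_pair_mean_concentration(2)[of "{0}" "\<lambda>_. 0" n "\<lambda>_. group_law P l" s B \<theta> t]
        n \<theta> F sets_group_law
      by (simp add: gini_delta_def mean_difference_def)
  qed
  finally show ?thesis .
qed

text \<open>The centre \<open>m\<close> is random, but a function of the labels only; for frozen
  labels it is exactly the mean of the class average, and the bound is the same for all label
  vectors.\<close>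

lemma class_mean_concentration:
  fixes n :: nat
  defines "m \<equiv> \<lambda>v. \<Sum>k\<in>labels. real (card {i \<in> {1..n}. v i = k}) / real n *
      (if card {i \<in> {1..n}. v i = k} < 2 then 0 else cond_gini_delta P l k)"
  assumes n: "1 \<le> n"
    and F: "\<And>k. k \<in> labels \<Longrightarrow> exp_moment_le (cond_group_law P l k) (\<lambda>x. nrm x) s B"
    and \<theta>: "0 < \<theta>" "\<theta> \<le> s / 4"
  shows "{z \<in> space (PiM {1..n} (\<lambda>_. law P)).
      t \<le> \<bar>class_mean n (sample_labels n z) (sample_proj n z) - m (sample_labels n z)\<bar>}
      \<in> sets (PiM {1..n} (\<lambda>_. law P))" (is "?E \<in> _")
    and "measure (PiM {1..n} (\<lambda>_. law P)) {z \<in> space (PiM {1..n} (\<lambda>_. law P)).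
      t \<le> \<bar>class_mean n (sample_labels n z) (sample_proj n z) - m (sample_labels n z)\<bar>}
    \<le> 2 * exp (real n * (16 * B * exp B / s\<^sup>2 * \<theta>\<^sup>2 - \<theta> * t))"
proof -
  let ?A = "\<lambda>v. {x \<in> space (PiM {1..n} (\<lambda>_. T)). t \<le> \<bar>class_mean n v x - m v\<bar>}"
  have eq: "?E = {z \<in> space (PiM {1..n} (\<lambda>_. law P)). sample_proj n z \<in> ?A (sample_labels n z)}"
    using sample_proj_in_space by auto
  show "?E \<in> sets (PiM {1..n} (\<lambda>_. law P))"
    unfolding eq by (rule sets_sample_event) measurable
  show "measure (PiM {1..n} (\<lambda>_. law P)) ?E \<le> 2 * exp (real n * (16 * B * exp B / s\<^sup>2 * \<theta>\<^sup>2 - \<theta> * t))"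
    unfolding eq
  proof (rule measure_sample_event)
    fix v :: "nat \<Rightarrow> nat" assume v: "\<And>i. v i \<in> labels"
    show "measure (PiM {1..n} (\<lambda>i. cond_group_law P l (v i))) (?A v)
        \<le> 2 * exp (real n * (16 * B * exp B / s\<^sup>2 * \<theta>\<^sup>2 - \<theta> * t))"
      unfolding m_def class_mean_def cond_gini_delta_def mean_difference_def
      by (rule classwise_pair_mean_concentration(2)[where F = "cond_group_law P l"])
        (fact finite_atLeastAtMost v n F \<theta>(1) \<theta>(2) | rule sets_cond_group_law)+
  qed measurable
qed

text \<open>Outside three bad events the denominator is off by less than \<open>t\<close> and the
  within-class term by less than \<open>3 * t\<close>: fluctuation given the labels, bias from
  singleton classes, and fluctuation of the label mean contribute \<open>t\<close> each. The factor
  of \<open>t\<close> on the left is the one from \<open>ratio_error\<close>, and three two-sided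
  tails give 6.\<close>

lemma gini_cor_concentration:
  fixes B s :: real
  defines "B' \<equiv> exp B"
  assumes n: "2 \<le> n" and s: "0 < s" and B: "0 \<le> B"
    and moment: "\<And>k. k \<in> labels \<Longrightarrow> (\<integral>\<^sup>+ x. ennreal (exp (s * nrm x)) \<partial>cond_group_law P l k) \<le> ennreal B"
    and \<delta>: "0 < \<delta>" "\<delta> \<le> gini_delta P l"
    and t: "t \<le> \<delta> / 2" "real (nclasses P) * (2 * B / s) / real n \<le> t"
    and \<theta>: "0 < \<theta>" "\<theta> \<le> s / 4"
  shows "measure (PiM {1..n} (\<lambda>_. law P)) {z \<in> space (PiM {1..n} (\<lambda>_. law P)).
      t * (6 / \<delta> + 2 * (2 * B / s) / \<delta>\<^sup>2) \<le> \<bar>gini_cor_hat P n z l - gini_cor P l\<bar>}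
    \<le> 6 * exp (real n * (16 * B' * exp B' / s\<^sup>2 * \<theta>\<^sup>2 - \<theta> * t))"
proof -
  let ?Q = "PiM {1..n} (\<lambda>_. law P)" and ?u = "2 * B / s"
  let ?b = "2 * exp (real n * (16 * B' * exp B' / s\<^sup>2 * \<theta>\<^sup>2 - \<theta> * t))"
  interpret Q: prob_space ?Q
    by (intro prob_space_PiM D.prob_space_axioms)
  have n1: "1 \<le> n"
    using n by simp
  have BB: "B \<le> B'" "0 \<le> B'"
    unfolding B'_def using exp_ge_add_one_self[of B] by (linarith, simp)
  have moment': "(\<integral>\<^sup>+ x. ennreal (exp (s * nrm x)) \<partial>cond_group_law P l k) \<le> ennreal B'" if "k \<in> labels" for k
    using moment[OF that] BB by (meson ennreal_leI order_trans)
  have F: "exp_moment_le (cond_group_law P l k) (\<lambda>x. nrm x) s B'" if "k \<in> labels" for k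
    using that s BB moment' by (intro exp_moment_cond_group_law) auto
  have G: "exp_moment_le (group_law P l) (\<lambda>x. nrm x) s B'"
    using s BB moment' by (intro exp_moment_group_law) auto
  have u: "0 \<le> cond_gini_delta P l k \<and> cond_gini_delta P l k \<le> ?u" if "k \<in> labels" for k
    using cond_gini_delta_bounds[OF exp_moment_cond_group_law[OF that s B moment[OF that]]] by auto
  define m where "m v = (\<Sum>k\<in>labels. real (card {i \<in> {1..n}. v i = k}) / real n *
      (if card {i \<in> {1..n}. v i = k} < 2 then 0 else cond_gini_delta P l k))" for v
  define g where "g = (\<Sum>k\<in>labels. class_prob P k * cond_gini_delta P l k)"
  have [measurable]: "full_mean n \<in> borel_measurable (PiM {1..n} (\<lambda>_. T))"
    by (rule pair_mean_measurable) auto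
  note integral_cond_gini_delta(1)[measurable]
  define E1 where "E1 = {z \<in> space ?Q. t \<le> \<bar>full_mean n (sample_proj n z) - gini_delta P l\<bar>}"
  define E2 where "E2 = {z \<in> space ?Q. t \<le> \<bar>class_mean n (sample_labels n z) (sample_proj n z) - m (sample_labels n z)\<bar>}"
  define E3 where "E3 = {z \<in> space ?Q. t \<le> \<bar>(\<Sum>i=1..n. cond_gini_delta P l (snd (z i))) / real n - g\<bar>}"
  have sets: "E1 \<in> sets ?Q" "E2 \<in> sets ?Q" "E3 \<in> sets ?Q"
  proof -
    show "E1 \<in> sets ?Q"
      unfolding E1_def by measurable
    show "E3 \<in> sets ?Q"
      unfolding E3_def by measurable
    show "E2 \<in> sets ?Q"
      unfolding E2_def m_def by (rule class_mean_concentration(1)[OF n1 F \<theta>])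
  qed
  have E1: "measure ?Q E1 \<le> ?b"
    unfolding E1_def using n by (intro full_mean_concentration G \<theta>)
  have E2: "measure ?Q E2 \<le> ?b"
    unfolding E2_def m_def by (rule class_mean_concentration(2)[OF n1 F \<theta>])
  have E3: "measure ?Q E3 \<le> ?b"
    unfolding E3_def g_def integral_cond_gini_delta(2)[symmetric]
    \<comment> \<open>With \<open>b = B / s\<close> the moment condition
      \<open>exp (s * b) \<le> B'\<close> holds with equality.\<close>
    by (rule bounded_mean_concentration[where b = "B / s"])
      (use u label_in s B n \<theta> integral_cond_gini_delta(1) D.prob_space_axioms in \<open>auto simp: B'_def\<close>)
  have g: "0 \<le> g" "g \<le> ?u"
  proof -
    show "0 \<le> g"
      unfolding g_def using u class_prob_pos by (intro sum_nonneg mult_nonneg_nonneg) (auto intro: less_imp_le)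
    have "g \<le> (\<Sum>k\<in>labels. class_prob P k * ?u)"
      unfolding g_def using u class_prob_pos by (intro sum_mono mult_left_mono) (auto intro: less_imp_le)
    also have "\<dots> = ?u"
      by (simp only: sum_distrib_right[symmetric] sum_class_prob mult_1_left)
    finally show "g \<le> ?u" .
  qed
  have "{z \<in> space ?Q. t * (6 / \<delta> + 2 * ?u / \<delta>\<^sup>2) \<le> \<bar>gini_cor_hat P n z l - gini_cor P l\<bar>} \<subseteq> E1 \<union> E2 \<union> E3"
  proof (rule ccontr)
    assume "\<not> ?thesis"
    then obtain z where z: "z \<in> space ?Q" "z \<notin> E1" "z \<notin> E2" "z \<notin> E3"
      "t * (6 / \<delta> + 2 * ?u / \<delta>\<^sup>2) \<le> \<bar>gini_cor_hat P n z l - gini_cor P l\<bar>"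
      by auto
    have lab: "sample_labels n z i \<in> labels" if "i \<in> {1..n}" for i
      using that z(1) label_in[of "z i"] by (auto simp: sample_labels_def space_PiM PiE_iff)
    have eq: "(\<Sum>i=1..n. cond_gini_delta P l (sample_labels n z i)) = (\<Sum>i=1..n. cond_gini_delta P l (snd (z i)))"
      by (intro sum.cong) (auto simp: sample_labels_def)
    have "\<bar>m (sample_labels n z) - (\<Sum>i=1..n. cond_gini_delta P l (sample_labels n z i)) / real n\<bar>
        \<le> real (card labels) * ?u / real n"
      unfolding m_def using n u lab by (intro class_mean_bias) auto
    also have "\<dots> \<le> t"
      using t(2) by simp
    finally have "\<bar>m (sample_labels n z) - (\<Sum>i=1..n. cond_gini_delta P l (snd (z i))) / real n\<bar> \<le> t"
      by (simp only: eq)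
    then have "\<bar>class_mean n (sample_labels n z) (sample_proj n z) - g\<bar> < 3 * t"
      using z(1,3,4) by (auto simp: E2_def E3_def simp del: One_nat_def)
    moreover have "\<bar>full_mean n (sample_proj n z) - gini_delta P l\<bar> < t"
      using z(1,2) by (simp add: E1_def)
    ultimately have "\<bar>gini_cor_hat P n z l - gini_cor P l\<bar> < t * (6 / \<delta> + 2 * ?u / \<delta>\<^sup>2)"
      unfolding gini_cor_hat_eq gini_cor_def g_def[symmetric]
      using \<delta> t(1) g by (intro ratio_error) auto
    with z(5) show False
      by simp
  qed
  then have "measure ?Q {z \<in> space ?Q. t * (6 / \<delta> + 2 * ?u / \<delta>\<^sup>2) \<le> \<bar>gini_cor_hat P n z l - gini_cor P l\<bar>}
      \<le> measure ?Q (E1 \<union> E2 \<union> E3)"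
    using sets by (intro Q.finite_measure_mono) auto
  also have "\<dots> \<le> ?b + ?b + ?b"
    using measure_Un_le[OF sets(1,2)] measure_Un_le[OF sets.Un[OF sets(1,2)] sets(3)] E1 E2 E3
    by linarith
  finally show ?thesis
    by simp
qed

end

section \<open>The screening bound\<close>

lemma condC2E:
  assumes "condC2 P"
  obtains s B where "0 < s" "0 \<le> B"
    "\<And>n l k. 1 \<le> n \<Longrightarrow> l \<in> {1..ngroups (P n)} \<Longrightarrow> k \<in> {1..nclasses (P n)} \<Longrightarrow>
       (\<integral>\<^sup>+ x. ennreal (exp (s * L2_set x (group (P n) l))) \<partial>(cond_group_law (P n) l k)) \<le> ennreal B"
proof -
  let ?f = "\<lambda>s n l k. \<integral>\<^sup>+ x. ennreal (exp (s * L2_set x (group (P n) l))) \<partial>(cond_group_law (P n) l k)"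
  let ?S = "\<lambda>s. SUP n\<in>{1..}. SUP l\<in>{1..ngroups (P n)}. SUP k\<in>{1..nclasses (P n)}. ?f s n l k"
  obtain s0 where s0: "s0 > 0" "\<forall>s\<in>{0..2 * s0}. ?S s < \<infinity>"
    using assms unfolding condC2_def by blast
  then have fin: "?S (2 * s0) < \<infinity>"
    by simp
  show ?thesis
  proof (rule that[of "2 * s0" "enn2real (?S (2 * s0))"])
    fix n l k assume "1 \<le> n" "l \<in> {1..ngroups (P n)}" "k \<in> {1..nclasses (P n)}"
    then have "?f (2 * s0) n l k \<le> ?S (2 * s0)"
      by (intro SUP_upper2[of n] SUP_upper2[of l] SUP_upper2[of k]) auto
    then show "?f (2 * s0) n l k \<le> ennreal (enn2real (?S (2 * s0)))"
      using fin by (simp only: ennreal_enn2real infinity_ennreal_def)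
  qed (use s0 in auto)
qed

section \<open>From an i.i.d. sample to the product space\<close>

lemma iid_sample_distr:
  assumes iid: "iid_sample M Z n D" and n: "1 \<le> n"
  shows "(\<lambda>w. \<lambda>i\<in>{1..n}. Z i w) \<in> measurable M (PiM {1..n} (\<lambda>_. D))"
    and "distr M (PiM {1..n} (\<lambda>_. D)) (\<lambda>w. \<lambda>i\<in>{1..n}. Z i w) = PiM {1..n} (\<lambda>_. D)"
proof -
  interpret prob_space M
    using iid by (simp add: iid_sample_def)
  have ind: "indep_vars (\<lambda>_. D) Z {1..n}" and dist: "\<And>i. i \<in> {1..n} \<Longrightarrow> distr M D (Z i) = D"
    using iid by (auto simp: iid_sample_def)
  have rv: "random_variable D (Z i)" if "i \<in> {1..n}" for i
    using ind that by (auto simp: indep_vars_def)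
  then show "(\<lambda>w. \<lambda>i\<in>{1..n}. Z i w) \<in> measurable M (PiM {1..n} (\<lambda>_. D))"
    by (intro measurable_restrict)
  have "{1..n} \<noteq> {}"
    using n by simp
  from indep_vars_iff_distr_eq_PiM'[where M' = "\<lambda>_. D" and X = Z, OF this] rv ind
  have "distr M (PiM {1..n} (\<lambda>_. D)) (\<lambda>w. \<lambda>i\<in>{1..n}. Z i w) = PiM {1..n} (\<lambda>i. distr M D (Z i))"
    by blast
  also have "\<dots> = PiM {1..n} (\<lambda>_. D)"
    by (rule PiM_cong[OF refl dist])
  finally show "distr M (PiM {1..n} (\<lambda>_. D)) (\<lambda>w. \<lambda>i\<in>{1..n}. Z i w) = PiM {1..n} (\<lambda>_. D)" .
qed

context population_group
begin

lemma gini_cor_hat_random_variable: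
  assumes iid: "iid_sample M Z n (law P)" and n: "1 \<le> n"
  shows "(\<lambda>w. gini_cor_hat P n (\<lambda>i. Z i w) l) \<in> borel_measurable M"
proof -
  have "(\<lambda>w. gini_cor_hat P n (\<lambda>i\<in>{1..n}. Z i w) l) \<in> borel_measurable M"
    by (rule measurable_compose[OF iid_sample_distr(1)[OF iid n] gini_cor_hat_measurable])
  then show ?thesis
    using gini_cor_hat_restrict[of P n "\<lambda>i. Z i _" l] by (simp only:)
qed

text \<open>The probability depends on the law of the first \<open>n\<close> observations alone, so
  all estimates can be made on the product space, where Fubini's theorem is available.\<close>

lemma measure_iid_sample:
  assumes iid: "iid_sample M Z n (law P)" and n: "1 \<le> n"
  shows "measure M {w \<in> space M. a \<le> \<bar>gini_cor_hat P n (\<lambda>i. Z i w) l - b\<bar>}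
    = measure (PiM {1..n} (\<lambda>_. law P)) {z \<in> space (PiM {1..n} (\<lambda>_. law P)). a \<le> \<bar>gini_cor_hat P n z l - b\<bar>}"
proof -
  let ?Q = "PiM {1..n} (\<lambda>_. law P)" and ?Z = "\<lambda>w. \<lambda>i\<in>{1..n}. Z i w"
  let ?A = "{z \<in> space ?Q. a \<le> \<bar>gini_cor_hat P n z l - b\<bar>}"
  note Z = iid_sample_distr[OF iid n]
  note gini_cor_hat_measurable[measurable]
  have "measure ?Q ?A = measure (distr M ?Q ?Z) ?A"
    by (simp only: Z(2))
  also have "\<dots> = measure M (?Z -` ?A \<inter> space M)"
    by (rule measure_distr[OF Z(1)]) measurable
  also have "?Z -` ?A \<inter> space M = {w \<in> space M. a \<le> \<bar>gini_cor_hat P n (\<lambda>i. Z i w) l - b\<bar>}"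
    using measurable_space[OF Z(1)] gini_cor_hat_restrict[of P n "\<lambda>i. Z i _" l] by auto
  finally show ?thesis ..
qed

end

section \<open>Choice of scales and absorption of constants\<close>

lemma error_rate_ge:
  assumes "1 \<le> n" "0 \<le> \<tau>"
  shows "exp (- (real n powr (1 - 2 * (\<kappa> + \<beta>)))) \<le> error_rate 1 1 1 \<kappa> \<beta> \<tau> n"
proof -
  have "exp (- (real n powr (1 - 2 * (\<kappa> + \<beta>)))) \<le> exp (- 1 * real n powr (1 - 2 * (\<kappa> + \<beta>)) + \<tau> * ln (real n))"
    using assms by simp
  then show ?thesis
    unfolding error_rate_def by (smt (verit) exp_gt_zero)
qed

text \<open>A strict gap between exponents absorbs any constant. It serves twice: the gap
  \<open>2 * \<beta>\<close> frees the rate from constants of the population sequence, and the gap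
  between \<open>\<tau> - 1\<close> and \<open>- \<kappa>\<close> makes the bias negligible.\<close>

lemma eventually_powr_le:
  fixes p q a :: real
  assumes "p < q" "0 < a"
  shows "\<forall>\<^sub>F n in sequentially. real n powr p \<le> a * real n powr q"
proof -
  have "((\<lambda>n. real n powr (p - q)) \<longlongrightarrow> 0) sequentially"
    using assms by (intro tendsto_neg_powr filterlim_real_sequentially) auto
  then have "\<forall>\<^sub>F n in sequentially. real n powr (p - q) < a"
    using assms by (intro order_tendstoD(2)) auto
  then show ?thesis
  proof eventually_elim
    case (elim n)
    have "real n powr p = real n powr (p - q) * real n powr q"
      by (simp add: powr_add[symmetric])
    also have "\<dots> \<le> a * real n powr q"
      using elim by (intro mult_right_mono) auto
    finally show ?case .
  qed
qed

text \<open>Both the deviation \<open>t\<close> and the Chernoff parameter \<open>\<theta>\<close>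
  are taken proportional to \<open>n powr (- \<kappa>)\<close>; then the exponent
  \<open>n * (A * \<theta>\<^sup>2 - \<theta> * t)\<close> is a negative multiple of
  \<open>n powr (1 - 2 * \<kappa>)\<close>. The threshold for \<open>n\<close> does not depend on
  the group.\<close>

lemma eventually_gini_cor_bound:
  fixes c \<kappa> c1 c2 \<beta> \<tau> :: real and P :: "nat \<Rightarrow> population"
  assumes c: "c > 0" and \<kappa>: "0 \<le> \<kappa>" and \<beta>: "0 < \<beta>" and \<tau>: "0 \<le> \<tau>" "\<tau> < 1 - 2 * \<kappa>"
    and P: "\<And>n. 1 \<le> n \<Longrightarrow> valid_population (P n)"
    and C1: "condC1 c1 c2 \<tau> P" and C2: "condC2 P" and nd: "nondegenerate P"
  shows "\<forall>\<^sub>F n in sequentially. \<forall>l\<in>{1..ngroups (P n)}.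
    measure (PiM {1..n} (\<lambda>_. law (P n))) {z \<in> space (PiM {1..n} (\<lambda>_. law (P n))).
      c * real n powr (- \<kappa>) \<le> \<bar>gini_cor_hat (P n) n z l - gini_cor (P n) l\<bar>}
    \<le> 6 * error_rate 1 1 1 \<kappa> \<beta> \<tau> n"
proof -
  obtain s B where s: "0 < s" and B: "0 \<le> B" and moment:
    "\<And>n l k. 1 \<le> n \<Longrightarrow> l \<in> {1..ngroups (P n)} \<Longrightarrow> k \<in> {1..nclasses (P n)} \<Longrightarrow>
       (\<integral>\<^sup>+ x. ennreal (exp (s * L2_set x (group (P n) l))) \<partial>(cond_group_law (P n) l k)) \<le> ennreal B"
    using C2 by (rule condC2E) blast
  obtain \<delta> where \<delta>: "0 < \<delta>" "\<And>n l. 1 \<le> n \<Longrightarrow> l \<in> {1..ngroups (P n)} \<Longrightarrow> \<delta> \<le> gini_delta (P n) l"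
    using nd by (auto simp: nondegenerate_def)
  obtain C where C: "0 < C" "\<forall>\<^sub>F n in sequentially. norm (real (nclasses (P n))) \<le> C * norm (real n powr \<tau>)"
    using C1 unfolding condC1_def by (auto elim: landau_o.bigE)
  define u where "u = 2 * B / s"
  define R where "R = 6 / \<delta> + 2 * u / \<delta>\<^sup>2"
  define B' where "B' = exp B"
  define A where "A = 16 * B' * exp B' / s\<^sup>2"
  \<comment> \<open>Scale of \<open>t\<close>: the first bound protects the denominator, the second
    ensures \<open>t * R \<le> c * n powr (- \<kappa>)\<close>.\<close>
  define \<eta> where "\<eta> = min (\<delta> / 2) (c / R)"
  \<comment> \<open>Scale of \<open>\<theta>\<close>: the first bound respects the exponential
    moment, the second keeps the quadratic term below half of the linear one.\<close>
  define \<epsilon> where "\<epsilon> = min (s / 4) (\<eta> / (2 * A))"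
  have u: "0 \<le> u"
    using s B by (simp add: u_def)
  have R: "0 < R"
    using \<delta>(1) u by (auto simp: R_def intro!: add_pos_nonneg)
  have A: "0 < A"
    using s by (simp add: A_def B'_def)
  have \<eta>: "0 < \<eta>" "\<eta> \<le> \<delta> / 2" "\<eta> * R \<le> c"
  proof -
    show "0 < \<eta>"
      using \<delta>(1) R c by (simp add: \<eta>_def)
    show "\<eta> \<le> \<delta> / 2"
      unfolding \<eta>_def by (rule min.cobounded1)
    have "\<eta> \<le> c / R"
      by (simp add: \<eta>_def)
    then show "\<eta> * R \<le> c"
      using R by (simp add: pos_le_divide_eq)
  qed
  have \<epsilon>: "0 < \<epsilon>" "\<epsilon> \<le> s / 4" "A * \<epsilon> \<le> \<eta> / 2"
  proof -
    show "0 < \<epsilon>"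
      using s A \<eta>(1) by (simp add: \<epsilon>_def)
    show "\<epsilon> \<le> s / 4"
      unfolding \<epsilon>_def by (rule min.cobounded1)
    have "\<epsilon> \<le> \<eta> / (2 * A)"
      by (simp add: \<epsilon>_def)
    then show "A * \<epsilon> \<le> \<eta> / 2"
      using A by (simp add: field_simps)
  qed
  have rate: "\<forall>\<^sub>F n in sequentially. real n powr (1 - 2 * (\<kappa> + \<beta>)) \<le> (\<epsilon> * \<eta> / 2) * real n powr (1 - 2 * \<kappa>)"
    using \<beta> \<epsilon>(1) \<eta>(1) by (intro eventually_powr_le) auto
  \<comment> \<open>Here \<open>\<tau> - 1 < - \<kappa>\<close> follows from
    \<open>\<tau> < 1 - 2 * \<kappa>\<close> and \<open>0 \<le> \<kappa>\<close>. The summand in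
    \<open>u + 1\<close> guards against division by zero when \<open>u = 0\<close>.\<close>
  have bias: "\<forall>\<^sub>F n in sequentially. real n powr (\<tau> - 1) \<le> (\<eta> / (C * (u + 1))) * real n powr (- \<kappa>)"
    using \<kappa> \<tau> \<eta>(1) C(1) u by (intro eventually_powr_le) auto
  show ?thesis
    using rate bias C(2) eventually_ge_at_top[of 2]
  proof eventually_elim
    case (elim n)
    show ?case
    proof
      fix l assume l: "l \<in> {1..ngroups (P n)}"
      have n: "2 \<le> n" "1 \<le> n"
        using elim(4) by auto
      interpret population_group "P n" l
        using P[OF n(2)] l by unfold_locales
      let ?Q = "PiM {1..n} (\<lambda>_. law (P n))"
      interpret Q: prob_space ?Q
        by (intro prob_space_PiM D.prob_space_axioms)
      define h where "h = real n powr (- \<kappa>)"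
      define t where "t = \<eta> * h"
      define \<theta> where "\<theta> = \<epsilon> * h"
      have h: "0 < h" "h \<le> 1"
        using n \<kappa> powr_mono[of "- \<kappa>" 0 "real n"] by (auto simp: h_def)
      have t: "t \<le> \<delta> / 2"
        using \<eta>(1,2) mult_left_mono[OF h(2), of \<eta>] unfolding t_def by linarith
      have \<theta>: "0 < \<theta>" "\<theta> \<le> s / 4"
        using \<epsilon>(1,2) h(1) mult_left_mono[OF h(2), of \<epsilon>] unfolding \<theta>_def by (simp, linarith)
      have K: "real (nclasses (P n)) * u / real n \<le> t"
      proof -
        have "real (nclasses (P n)) * u / real n \<le> C * real n powr \<tau> * (u + 1) / real n"
          using elim(3) u n by (intro divide_right_mono mult_mono) auto
        also have "\<dots> = C * (u + 1) * real n powr (\<tau> - 1)"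
          using n by (simp add: powr_diff)
        also have "\<dots> \<le> C * (u + 1) * (\<eta> / (C * (u + 1)) * h)"
          unfolding h_def using elim(2) C(1) u by (intro mult_left_mono) auto
        also have "\<dots> = t"
          using C(1) u by (simp add: t_def)
        finally show ?thesis .
      qed
      have tR: "t * R \<le> c * h"
        using \<eta>(3) h by (simp add: t_def mult.commute mult.left_commute)
      have "measure ?Q {z \<in> space ?Q. c * real n powr (- \<kappa>) \<le> \<bar>gini_cor_hat (P n) n z l - gini_cor (P n) l\<bar>}
          \<le> measure ?Q {z \<in> space ?Q. t * R \<le> \<bar>gini_cor_hat (P n) n z l - gini_cor (P n) l\<bar>}"
        using tR gini_cor_hat_measurable[measurable] by (intro Q.finite_measure_mono) (auto simp: h_def)
      also have "\<dots> \<le> 6 * exp (real n * (A * \<theta>\<^sup>2 - \<theta> * t))"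
        unfolding R_def u_def A_def B'_def
        using K by (intro gini_cor_concentration n s B moment l \<delta> t \<theta>) (auto simp: u_def)
      also have "\<dots> \<le> 6 * exp (- (real n powr (1 - 2 * (\<kappa> + \<beta>))))"
      proof -
        have "A * \<theta>\<^sup>2 - \<theta> * t = h\<^sup>2 * \<epsilon> * (A * \<epsilon> - \<eta>)"
          by (simp add: \<theta>_def t_def power2_eq_square algebra_simps)
        also have "\<dots> \<le> h\<^sup>2 * \<epsilon> * (- \<eta> / 2)"
          using \<epsilon> by (intro mult_left_mono) auto
        finally have "real n * (A * \<theta>\<^sup>2 - \<theta> * t) \<le> real n * (h\<^sup>2 * \<epsilon> * (- \<eta> / 2))"
          by (intro mult_left_mono) auto
        also have "\<dots> = - ((\<epsilon> * \<eta> / 2) * (real n * h\<^sup>2))"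
          by simp
        also have "real n * h\<^sup>2 = real n powr (1 - 2 * \<kappa>)"
          using n by (simp add: h_def power2_eq_square powr_add[symmetric] powr_mult_base)
        finally show ?thesis
          using elim(1) by simp
      qed
      also have "\<dots> \<le> 6 * error_rate 1 1 1 \<kappa> \<beta> \<tau> n"
        using error_rate_ge[OF n(2) \<tau>(1)] by (intro mult_left_mono) auto
      finally show "measure ?Q {z \<in> space ?Q. c * real n powr (- \<kappa>) \<le> \<bar>gini_cor_hat (P n) n z l - gini_cor (P n) l\<bar>}
        \<le> 6 * error_rate 1 1 1 \<kappa> \<beta> \<tau> n" .
    qed
  qed
qed

lemma error_rate_pos: "0 < error_rate b1 b2 b3 \<kappa> \<beta> \<tau> n"
  by (simp add: error_rate_def add_pos_pos)

theorem theorem2p1: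
  fixes c \<kappa> c1 c2 \<beta> \<tau> :: real
  assumes "c > 0" and "0 \<le> \<kappa>" and "\<kappa> < 1 / 2"
    and "c1 > 0" and "c2 > 0"
    and "0 < \<beta>" and "\<beta> < 1 / 2 - \<kappa>"
    and "0 \<le> \<tau>" and "\<tau> < 1 - 2 * \<kappa>"
  shows "\<exists>b1>0. \<exists>b2>0. \<exists>b3>0.
    \<forall>(P :: nat \<Rightarrow> population) (M :: nat \<Rightarrow> 'w measure) (Z :: nat \<Rightarrow> nat \<Rightarrow> 'w \<Rightarrow> (nat \<Rightarrow> real) \<times> nat).
      (\<forall>n\<ge>1. valid_population (P n) \<and> iid_sample (M n) (Z n) n (law (P n))) \<longrightarrow>
      condC1 c1 c2 \<tau> P \<longrightarrow> condC2 P \<longrightarrow> nondegenerate P \<longrightarrow>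
      (\<lambda>n. measure (M n) {w \<in> space (M n).
             (MAX l\<in>{1..ngroups (P n)}.
                \<bar>gini_cor_hat (P n) n (\<lambda>i. Z n i w) l - gini_cor (P n) l\<bar>) \<ge> c * real n powr (- \<kappa>)})
        \<in> O(\<lambda>n. real (ngroups (P n)) * error_rate b1 b2 b3 \<kappa> \<beta> \<tau> n) \<and>
      (condC3 c \<kappa> P \<longrightarrow>
       (\<lambda>n. 1 - measure (M n) {w \<in> space (M n).
             active_set (P n) \<subseteq> active_set_hat (P n) c \<kappa> n (\<lambda>i. Z n i w)})
        \<in> O(\<lambda>n. real (card (active_set (P n))) * error_rate b1 b2 b3 \<kappa> \<beta> \<tau> n))"
proof (intro exI[of _ 1] conjI zero_less_one allI impI)
  fix P :: "nat \<Rightarrow> population" and M :: "nat \<Rightarrow> 'w measure"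
    and Z :: "nat \<Rightarrow> nat \<Rightarrow> 'w \<Rightarrow> (nat \<Rightarrow> real) \<times> nat"
  assume PM: "\<forall>n\<ge>1. valid_population (P n) \<and> iid_sample (M n) (Z n) n (law (P n))"
    and C: "condC1 c1 c2 \<tau> P" "condC2 P" "nondegenerate P"
  let ?dev = "\<lambda>n w l. \<bar>gini_cor_hat (P n) n (\<lambda>i. Z n i w) l - gini_cor (P n) l\<bar>"
  let ?a = "\<lambda>n. c * real n powr (- \<kappa>)" and ?err = "error_rate 1 1 1 \<kappa> \<beta> \<tau>"
  \<comment> \<open>The event that group \<open>l\<close> deviates; both claims are union bounds
    over such events.\<close>
  define E where "E n l = {w \<in> space (M n). ?a n \<le> ?dev n w l}" for n l
  have valid: "valid_population (P n)" and iid: "iid_sample (M n) (Z n) n (law (P n))"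
    and prob: "prob_space (M n)" if "1 \<le> n" for n
    using PM that by (auto simp: iid_sample_def)
  have rv: "(\<lambda>w. gini_cor_hat (P n) n (\<lambda>i. Z n i w) l) \<in> borel_measurable (M n)"
    if "1 \<le> n" "l \<in> {1..ngroups (P n)}" for n l
    using valid[OF that(1)] that
    by (intro population_group.gini_cor_hat_random_variable[OF _ iid]) (auto simp: population_group_def)
  have E_sets: "E n l \<in> sets (M n)" if "1 \<le> n" "l \<in> {1..ngroups (P n)}" for n l
    unfolding E_def using rv[OF that, measurable] by measurable
  have "\<forall>\<^sub>F n in sequentially. \<forall>l\<in>{1..ngroups (P n)}.
    measure (PiM {1..n} (\<lambda>_. law (P n))) {z \<in> space (PiM {1..n} (\<lambda>_. law (P n))).
      ?a n \<le> \<bar>gini_cor_hat (P n) n z l - gini_cor (P n) l\<bar>} \<le> 6 * ?err n"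
    by (rule eventually_gini_cor_bound[OF assms(1,2,6,8,9) _ C]) (rule valid)
  then have bound: "\<forall>\<^sub>F n in sequentially. \<forall>l\<in>{1..ngroups (P n)}. measure (M n) (E n l) \<le> 6 * ?err n"
    using eventually_ge_at_top[of 1]
  proof eventually_elim
    case (elim n)
    show ?case
    proof
      fix l assume l: "l \<in> {1..ngroups (P n)}"
      have "population_group (P n) l"
        using valid[OF elim(2)] l by (simp add: population_group_def)
      from population_group.measure_iid_sample[OF this iid[OF elim(2)] elim(2)] elim(1) l
      show "measure (M n) (E n l) \<le> 6 * ?err n"
        by (simp only: E_def)
    qed
  qed
  \<comment> \<open>Quantifying over \<open>S\<close> and \<open>L\<close> inside the eventuality
    serves both claims: \<open>L\<close> is the set of all groups or the active set. The set
    \<open>S\<close> may be arbitrary, since monotonicity only uses measurability of the union. For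
    empty \<open>L\<close> the bound is 0, in accordance with \<open>d_n = 0\<close>.\<close>
  have union_bound: "\<forall>\<^sub>F n in sequentially. \<forall>S L. L \<subseteq> {1..ngroups (P n)} \<longrightarrow>
      S \<subseteq> (\<Union>l\<in>L. E n l) \<longrightarrow> measure (M n) S \<le> 6 * (real (card L) * ?err n)"
    using bound eventually_ge_at_top[of 1]
  proof eventually_elim
    case (elim n)
    interpret prob_space "M n"
      by (rule prob[OF elim(2)])
    show ?case
    proof (intro allI impI)
      fix S L assume L: "L \<subseteq> {1..ngroups (P n)}" and S: "S \<subseteq> (\<Union>l\<in>L. E n l)"
      have fin: "finite L"
        using L finite_subset by auto
      have sets: "E n l \<in> sets (M n)" if "l \<in> L" for l
        using E_sets elim(2) that L by blast
      have "measure (M n) S \<le> measure (M n) (\<Union>l\<in>L. E n l)"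
        using S fin sets by (intro finite_measure_mono sets.finite_UN) auto
      also have "\<dots> \<le> (\<Sum>l\<in>L. measure (M n) (E n l))"
        using fin sets by (intro finite_measure_subadditive_finite) auto
      also have "\<dots> \<le> (\<Sum>l\<in>L. 6 * ?err n)"
        using elim(1) L by (intro sum_mono) auto
      finally show "measure (M n) S \<le> 6 * (real (card L) * ?err n)"
        by (simp add: mult.left_commute)
    qed
  qed
  have "\<forall>\<^sub>F n in sequentially. norm (measure (M n) {w \<in> space (M n). ?a n \<le> (MAX l\<in>{1..ngroups (P n)}. ?dev n w l)})
      \<le> 6 * norm (real (ngroups (P n)) * ?err n)"
    using union_bound eventually_ge_at_top[of 1]
  proof eventually_elim
    case (elim n)
    have ne: "{1..ngroups (P n)} \<noteq> {}"
      using valid[OF elim(2)] by (simp add: valid_population_def)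
    have "{w \<in> space (M n). ?a n \<le> (MAX l\<in>{1..ngroups (P n)}. ?dev n w l)} \<subseteq> (\<Union>l\<in>{1..ngroups (P n)}. E n l)"
      using ne by (auto simp: E_def Max_ge_iff simp del: One_nat_def)
    from elim(1)[rule_format, OF order_refl this] show ?case
      using error_rate_pos[of 1 1 1 \<kappa> \<beta> \<tau> n] by (simp add: abs_mult)
  qed
  then show "(\<lambda>n. measure (M n) {w \<in> space (M n). ?a n \<le> (MAX l\<in>{1..ngroups (P n)}. ?dev n w l)})
      \<in> O(\<lambda>n. real (ngroups (P n)) * ?err n)"
    by (rule bigoI)
  assume C3: "condC3 c \<kappa> P"
  have "\<forall>\<^sub>F n in sequentially. norm (1 - measure (M n) {w \<in> space (M n).
             active_set (P n) \<subseteq> active_set_hat (P n) c \<kappa> n (\<lambda>i. Z n i w)})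
      \<le> 6 * norm (real (card (active_set (P n))) * ?err n)"
    using union_bound eventually_ge_at_top[of 1]
  proof eventually_elim
    case (elim n)
    interpret prob_space "M n"
      by (rule prob[OF elim(2)])
    let ?S = "{w \<in> space (M n). active_set (P n) \<subseteq> active_set_hat (P n) c \<kappa> n (\<lambda>i. Z n i w)}"
    have act: "active_set (P n) \<subseteq> {1..ngroups (P n)}"
      by (auto simp: active_set_def)
    then have fin: "finite (active_set (P n))"
      using finite_subset by auto
    have S: "?S = {w \<in> space (M n). \<forall>l\<in>active_set (P n). ?a n \<le> gini_cor_hat (P n) n (\<lambda>i. Z n i w) l}"
      using act by (auto simp: active_set_hat_def)
    have S_sets: "?S \<in> sets (M n)"
      unfolding S
    proof (rule sets.sets_Collect_finite_All[OF _ fin])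
      fix l assume "l \<in> active_set (P n)"
      then have "l \<in> {1..ngroups (P n)}"
        using act by auto
      note rv[OF elim(2) this, measurable]
      show "{w \<in> space (M n). ?a n \<le> gini_cor_hat (P n) n (\<lambda>i. Z n i w) l} \<in> sets (M n)"
        by measurable
    qed
    \<comment> \<open>Missing an active group means that an estimate below
      \<open>c * n powr (- \<kappa>)\<close> meets a correlation of at least twice that value, so
      the deviation exceeds the threshold.\<close>
    have "space (M n) - ?S \<subseteq> (\<Union>l\<in>active_set (P n). E n l)"
    proof
      fix w assume "w \<in> space (M n) - ?S"
      then obtain l where w: "w \<in> space (M n)" and l: "l \<in> active_set (P n)"
        "gini_cor_hat (P n) n (\<lambda>i. Z n i w) l < ?a n"
        unfolding S by (auto simp: not_le)
      have "2 * ?a n \<le> gini_cor (P n) l"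
        using C3 elim(2) l(1) by (auto simp: condC3_def mult.assoc)
      with l(2) have "?a n \<le> ?dev n w l"
        by linarith
      with w l(1) show "w \<in> (\<Union>l\<in>active_set (P n). E n l)"
        by (auto simp: E_def)
    qed
    from elim(1)[rule_format, OF act this] show ?case
      using prob_compl[OF S_sets] error_rate_pos[of 1 1 1 \<kappa> \<beta> \<tau> n] by (simp add: abs_mult)
  qed
  then show "(\<lambda>n. 1 - measure (M n) {w \<in> space (M n).
             active_set (P n) \<subseteq> active_set_hat (P n) c \<kappa> n (\<lambda>i. Z n i w)})
        \<in> O(\<lambda>n. real (card (active_set (P n))) * ?err n)"
    by (rule bigoI)
qed

end
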